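(* Let $\alpha\in(0,1)\setminus\mathbb{Q}$, let $(\mathsf{X}_\alpha,\sigma_\alpha)$ be the associated one-sided Sturmian subshift with branch point $\omega_\alpha$, and let $\tilde{\mathsf{X}}_\alpha$ be its cover, with canonical factor map $\pi_\alpha\colon\tilde{\mathsf{X}}_\alpha\to\mathsf{X}_\alpha$ and canonical section $\iota_\alpha\colon\mathsf{X}_\alpha\to\tilde{\mathsf{X}}_\alpha$. Then $\pi_\alpha$ is (1) three-to-one on the forward orbit $\mathrm{orb}_\alpha^+(\omega_\alpha):=\{\sigma_\alpha^k(\omega_\alpha):k\geq 0\}$ (i.e. $\pi_\alpha^{-1}(x)$ has exactly three elements for each $x$ in this set); (2) two-to-one on the backward orbit $\mathrm{orb}_\alpha^-(\omega_\alpha):=\mathrm{orb}_\alpha(\omega_\alpha)\setminus\mathrm{orb}_\alpha^+(\omega_\alpha)$; and (3) one-to-one otherwise (i.e. $\pi_\alpha^{-1}(x)$ is a singleton for each $x\in\mathsf{X}_\alpha\setminus\mathrm{orb}_\alpha(\omega_\alpha)$). Moreover, $\iota_\alpha(\mathrm{orb}_\alpha(\omega_\alpha))\subseteq\tilde{\mathsf{X}}_\alpha$ is exactly the set of isolated points of $\tilde{\mathsf{X}}_\alpha$.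
   Context: Here $\mathbb{N}=\{0,1,2,\dots\}$ and $\mathbb{T}=\mathbb{R}/\mathbb{Z}$. Sturmian subshift. For irrational $\alpha\in(0,1)$ let $R_\alpha\colon\mathbb{T}\to\mathbb{T}$, $R_\alpha(t)=t+\alpha \pmod 1$, and let $I_\alpha\colon\mathbb{T}\to\{0,1\}$ be $I_\alpha(t)=0$ for $t\in[0,1-\alpha)$ and $I_\alpha(t)=1$ for $t\in[1-\alpha,1)$. The one-sided Sturmian subshift is $\mathsf{X}_\alpha=\overline{\{(I_\alpha(R_\alpha^i(t)))_{i\in\mathbb{N}}:t\in\mathbb{T}\}}\subseteq\{0,1\}^{\mathbb{N}}$ with $\sigma_\alpha(x)_i=x_{i+1}$; one has $\sigma_\alpha(\mathsf{X}_\alpha)=\mathsf{X}_\alpha$. The orbit of $x\in\mathsf{X}_\alpha$ is $\mathrm{orb}_\alpha(x)=\bigcup_{k,l\in\mathbb{N}}\sigma_\alpha^{-l}(\sigma_\alpha^k(x))$. The branch point $\omega_\alpha\in\mathsf{X}_\alpha$ is the unique point with more than one preimage under $\sigma_\alpha$; it satisfies $\sigma_\alpha^{-1}(\omega_\alpha)=\{0\omega_\alpha,1\omega_\alpha\}$. Cover. Let $\mathsf{X}\subseteq\{1,\dots,N\}^{\mathbb{N}}$ (or over any finite alphabet) be closed with $\sigma_{\mathsf{X}}(\mathsf{X})=\mathsf{X}$, where $\sigma_{\mathsf{X}}(x)_i=x_{i+1}$. For $l\in\mathbb{N}$ and $x\in\mathsf{X}$, let $P_l(x)$ be the set of words $\mu$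 of length $l$ with $\mu x\in\mathsf{X}$. Let $\mathcal{I}=\{(k,l)\in\mathbb{N}\times\mathbb{N}:k\leq l\}$, partially ordered by $(k_1,l_1)\preceq(k_2,l_2)$ iff $k_1\leq k_2$ and $l_1-k_1\leq l_2-k_2$. For $(k,l)\in\mathcal{I}$ write $x\sim_{k,l}x'$ iff $x_{[0,k)}=x'_{[0,k)}$ and $P_l(\sigma_{\mathsf{X}}^k(x))=P_l(\sigma_{\mathsf{X}}^k(x'))$; let ${}_k[x]_l$ be the class of $x$ and ${}_k\mathsf{X}_l$ the finite (discrete) set of classes. If $(k_1,l_1)\preceq(k_2,l_2)$ there is a well-defined surjection ${}_{k_2}\mathsf{X}_{l_2}\to{}_{k_1}\mathsf{X}_{l_1}$, ${}_{k_2}[x]_{l_2}\mapsto{}_{k_1}[x]_{l_1}$. The cover $\tilde{\mathsf{X}}$ is the projective limit of this system (with the inverse limit topology). For $\tilde{x}\in\tilde{\mathsf{X}}$, let ${}_k\tilde{x}_l\in\mathsf{X}$ denote any representative of its $(k,l)$-coordinate. The map $\pi_{\mathsf{X}}\colon\tilde{\mathsf{X}}\to\mathsf{X}$ sends $\tilde{x}$ to the unique $x$ with $x_{[0,k)}=({}_k\tilde{x}_l)_{[0,k)}$ for all $(k,l)\in\mathcal{I}$, and $\iota_{\mathsf{X}}\colon\mathsf{X}\to\tilde{\mathsf{X}}$ sends $x$ to the element with $(k,l)$-coordinate ${}_k[x]_l$ for all $(k,l)\in\mathcal{I}$. For $\mathsf{X}=\mathsf{X}_\alpha$ write $\tilde{\mathsf{X}}_\alpha,\pi_\alpha,\iota_\alpha$.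 *)

theory Defs
  imports "HOL-Analysis.Analysis" "HOL-Library.Omega_Words_Fun"
begin

text \<open>
  One-sided infinite words are functions \<open>nat \<Rightarrow> 'a\<close>, as in \<^theory>\<open>HOL-Library.Omega_Words_Fun\<close>:
  \<open>suffix k x\<close> is the $k$-fold shift of \<open>x\<close>, \<open>prefix k x\<close> is the word $x_{[0,k)}$, and
  \<open>conc \<mu> x\<close> is the concatenation $\mu x$.
\<close>

section \<open>Orbits and branch points in a one-sided shift space\<close>

definition orb :: "(nat \<Rightarrow> 'a) set \<Rightarrow> (nat \<Rightarrow> 'a) \<Rightarrow> (nat \<Rightarrow> 'a) set" where
  "orb X x = (\<Union>k. \<Union>l. {y \<in> X. suffix l y = suffix k x})"

definition forward_orb :: "(nat \<Rightarrow> 'a) \<Rightarrow> (nat \<Rightarrow> 'a) set" where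
  "forward_orb x = {suffix k x | k. True}"

definition backward_orb :: "(nat \<Rightarrow> 'a) set \<Rightarrow> (nat \<Rightarrow> 'a) \<Rightarrow> (nat \<Rightarrow> 'a) set" where
  "backward_orb X x = orb X x - forward_orb x"

definition branch_point :: "(nat \<Rightarrow> 'a) set \<Rightarrow> (nat \<Rightarrow> 'a)" where
  "branch_point X =
     (THE x. x \<in> X \<and> (\<exists>y\<in>X. \<exists>z\<in>X. y \<noteq> z \<and> suffix 1 y = x \<and> suffix 1 z = x))"

section \<open>Sturmian subshifts\<close>

text \<open>The circle $\mathbb{R}/\mathbb{Z}$ is represented by the fundamental domain $[0,1)$.\<close>

definition rotation :: "real \<Rightarrow> real \<Rightarrow> real" where
  "rotation \<alpha> t = frac (t + \<alpha>)"

definition coding :: "real \<Rightarrow> real \<Rightarrow> nat" where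
  "coding \<alpha> t = (if t < 1 - \<alpha> then 0 else 1)"

text \<open>
  The closure is taken in the product topology on \<open>nat \<Rightarrow> nat\<close> with \<open>nat\<close> discrete, in which
  $\{0,1\}^{\mathbb{N}}$ is a closed subspace.
\<close>

definition sturmian :: "real \<Rightarrow> (nat \<Rightarrow> nat) set" where
  "sturmian \<alpha> = closure {(\<lambda>i. coding \<alpha> ((rotation \<alpha> ^^ i) t)) | t. t \<in> {0..<1}}"

section \<open>The cover of a one-sided shift space\<close>

definition pasts :: "(nat \<Rightarrow> 'a) set \<Rightarrow> nat \<Rightarrow> (nat \<Rightarrow> 'a) \<Rightarrow> 'a list set" where
  "pasts X l x = {\<mu>. length \<mu> = l \<and> conc \<mu> x \<in> X}"

definition cover_index :: "(nat \<times> nat) set" where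
  "cover_index = {(k, l). k \<le> l}"

definition index_le :: "nat \<times> nat \<Rightarrow> nat \<times> nat \<Rightarrow> bool" where
  "index_le = (\<lambda>(k1, l1) (k2, l2). k1 \<le> k2 \<and> l1 - k1 \<le> l2 - k2)"

definition past_rel :: "(nat \<Rightarrow> 'a) set \<Rightarrow> nat \<times> nat \<Rightarrow> ((nat \<Rightarrow> 'a) \<times> (nat \<Rightarrow> 'a)) set" where
  "past_rel X = (\<lambda>(k, l). {(x, y). x \<in> X \<and> y \<in> X \<and> prefix k x = prefix k y \<and>
      pasts X l (suffix k x) = pasts X l (suffix k y)})"

definition past_class :: "(nat \<Rightarrow> 'a) set \<Rightarrow> nat \<times> nat \<Rightarrow> (nat \<Rightarrow> 'a) \<Rightarrow> (nat \<Rightarrow> 'a) set" where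
  "past_class X i x = past_rel X i `` {x}"

definition class_space :: "(nat \<Rightarrow> 'a) set \<Rightarrow> nat \<times> nat \<Rightarrow> (nat \<Rightarrow> 'a) set set" where
  "class_space X i = X // past_rel X i"

text \<open>
  The bonding map into the classes of index \<open>i\<close> sends a class \<open>A\<close> of a larger index to the union
  of the \<open>i\<close>-classes of the elements of \<open>A\<close>. These all coincide, see \<open>bond_past_class\<close> below.
\<close>

definition bond :: "(nat \<Rightarrow> 'a) set \<Rightarrow> nat \<times> nat \<Rightarrow> (nat \<Rightarrow> 'a) set \<Rightarrow> (nat \<Rightarrow> 'a) set" where
  "bond X i A = past_rel X i `` A"

definition cover :: "(nat \<Rightarrow> 'a) set \<Rightarrow> (nat \<times> nat \<Rightarrow> (nat \<Rightarrow> 'a) set) set" where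
  "cover X = {p \<in> Pi\<^sub>E cover_index (class_space X).
     \<forall>i\<in>cover_index. \<forall>j\<in>cover_index. index_le i j \<longrightarrow> bond X i (p j) = p i}"

definition cover_topology :: "(nat \<Rightarrow> 'a) set \<Rightarrow> (nat \<times> nat \<Rightarrow> (nat \<Rightarrow> 'a) set) topology" where
  "cover_topology X = subtopology
     (product_topology (\<lambda>i. discrete_topology (class_space X i)) cover_index) (cover X)"

definition cover_proj :: "(nat \<Rightarrow> 'a) set \<Rightarrow> (nat \<times> nat \<Rightarrow> (nat \<Rightarrow> 'a) set) \<Rightarrow> (nat \<Rightarrow> 'a)" where
  "cover_proj X p =
     (THE x. x \<in> X \<and> (\<forall>(k, l)\<in>cover_index. \<forall>y\<in>p (k, l). prefix k x = prefix k y))"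

definition cover_section :: "(nat \<Rightarrow> 'a) set \<Rightarrow> (nat \<Rightarrow> 'a) \<Rightarrow> (nat \<times> nat \<Rightarrow> (nat \<Rightarrow> 'a) set)" where
  "cover_section X x = (\<lambda>i\<in>cover_index. past_class X i x)"

definition cover_fibre ::
  "(nat \<Rightarrow> 'a) set \<Rightarrow> (nat \<Rightarrow> 'a) \<Rightarrow> (nat \<times> nat \<Rightarrow> (nat \<Rightarrow> 'a) set) set" where
  "cover_fibre X x = {p \<in> cover X. cover_proj X p = x}"

definition isolated_points :: "'b topology \<Rightarrow> 'b set" where
  "isolated_points T = {p \<in> topspace T. openin T {p}}"

section \<open>Well-definedness\<close>

lemma equiv_past_rel: "equiv X (past_rel X i)"
  by (cases i) (auto simp: past_rel_def equiv_def refl_on_def sym_def trans_def)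

lemma topspace_cover_topology: "topspace (cover_topology X) = cover X"
  by (auto simp: cover_topology_def cover_def)

lemma suffix_closed:
  assumes "suffix 1 ` X = X" "x \<in> X"
  shows "suffix n x \<in> X"
proof (induction n)
  case (Suc n)
  have "suffix 1 (suffix n x) \<in> X" using Suc assms(1) by blast
  then show ?case unfolding suffix_suffix by (metis Suc_eq_plus1)
qed (use assms in simp)

lemma left_extension:
  assumes "suffix 1 ` X = X" "x \<in> X"
  shows "\<exists>\<nu>. length \<nu> = n \<and> conc \<nu> x \<in> X"
proof (induction n)
  case 0
  then show ?case using assms by simp
next
  case (Suc n)
  then obtain \<nu> where \<nu>: "length \<nu> = n" "conc \<nu> x \<in> X" by blast
  then obtain y where y: "y \<in> X" "conc \<nu> x = suffix 1 y" using assms(1) by blast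
  have "y = conc [y 0] (suffix 1 y)" by (auto simp: conc_def fun_eq_iff)
  then have "conc (y 0 # \<nu>) x \<in> X" using y by (metis append_Cons append_Nil conc_conc)
  then show ?case using \<nu>(1) by (metis length_Cons)
qed

lemma past_rel_mono:
  assumes X: "suffix 1 ` X = X"
    and ij: "i \<in> cover_index" "j \<in> cover_index" "index_le i j"
    and xy: "(x, y) \<in> past_rel X j"
  shows "(x, y) \<in> past_rel X i"
proof -
  obtain k1 l1 k2 l2 where e: "i = (k1, l1)" "j = (k2, l2)" by fastforce
  have le: "k1 \<le> l1" "k2 \<le> l2" "k1 \<le> k2" "l1 - k1 \<le> l2 - k2"
    using ij by (auto simp: e cover_index_def index_le_def)
  have main: "pasts X l1 (suffix k1 x) \<subseteq> pasts X l1 (suffix k1 y)"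
    if xy: "prefix k2 x = prefix k2 y"
      "pasts X l2 (suffix k2 x) = pasts X l2 (suffix k2 y)" for x y
  proof
    fix \<mu> assume "\<mu> \<in> pasts X l1 (suffix k1 x)"
    then have \<mu>: "length \<mu> = l1" "conc \<mu> (suffix k1 x) \<in> X" by (auto simp: pasts_def)
    define w where "w = map x [k1..<k2]"
    have split: "suffix k1 z = conc (map z [k1..<k2]) (suffix k2 z)" for z :: "nat \<Rightarrow> 'a"
      using le by (auto simp: conc_def fun_eq_iff add.commute)
    have wy: "w = map y [k1..<k2]"
      using xy(1) unfolding w_def subsequence_def by auto
    obtain \<nu> where \<nu>: "length \<nu> = l2 - (l1 + (k2 - k1))" "conc \<nu> (conc \<mu> (suffix k1 x)) \<in> X"
      using left_extension[OF X \<mu>(2)] by blast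
    have "\<nu> @ \<mu> @ w \<in> pasts X l2 (suffix k2 x)"
      using \<nu> \<mu>(1) le split[of x] by (simp add: pasts_def w_def)
    then have "conc (\<nu> @ \<mu> @ w) (suffix k2 y) \<in> X"
      unfolding xy(2) by (simp add: pasts_def)
    then have "conc \<nu> (conc \<mu> (suffix k1 y)) \<in> X"
      using split[of y] wy by simp
    then have "suffix (length \<nu>) (conc \<nu> (conc \<mu> (suffix k1 y))) \<in> X"
      by (rule suffix_closed[OF X])
    moreover have "suffix (length \<nu>) (conc \<nu> z) = z" for z
      by (auto simp: conc_def fun_eq_iff)
    ultimately show "\<mu> \<in> pasts X l1 (suffix k1 y)" using \<mu>(1) by (simp add: pasts_def)
  qed
  have "prefix k1 x = prefix k1 y"
    using xy le unfolding e past_rel_def subsequence_def by auto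
  then show ?thesis
    using xy main[of x y] main[of y x] by (auto simp: e past_rel_def)
qed

lemma bond_past_class:
  assumes X: "suffix 1 ` X = X" and x: "x \<in> X"
    and ij: "i \<in> cover_index" "j \<in> cover_index" "index_le i j"
  shows "bond X i (past_class X j x) = past_class X i x"
proof -
  have "(x, x) \<in> past_rel X j" using x equiv_past_rel by (metis equiv_class_eq_iff)
  moreover have "trans (past_rel X i)" "sym (past_rel X i)"
    using equiv_past_rel[of X i] by (auto simp: equiv_def)
  ultimately show ?thesis
    using past_rel_mono[OF X ij] unfolding bond_def past_class_def
    by (auto dest: transD symD)
qed

lemma cover_section_in_cover:
  assumes "suffix 1 ` X = X" "x \<in> X"
  shows "cover_section X x \<in> cover X"
  using assms bond_past_class[OF assms]
  by (auto simp: cover_def cover_section_def class_space_def past_class_def quotientI)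

lemma cover_proj_section:
  assumes "x \<in> X"
  shows "cover_proj X (cover_section X x) = x"
  unfolding cover_proj_def
proof (rule the_equality)
  show "x \<in> X \<and> (\<forall>(k, l)\<in>cover_index. \<forall>y\<in>cover_section X x (k, l). prefix k x = prefix k y)"
    using assms by (auto simp: cover_section_def past_class_def past_rel_def)
next
  fix z
  assume z: "z \<in> X \<and> (\<forall>(k, l)\<in>cover_index. \<forall>y\<in>cover_section X x (k, l). prefix k z = prefix k y)"
  have "prefix k z = prefix k x" for k
  proof -
    have "(k, k) \<in> cover_index" by (simp add: cover_index_def)
    moreover from this have "x \<in> cover_section X x (k, k)"
      using assms by (auto simp: cover_section_def past_class_def past_rel_def)
    ultimately show ?thesis using z by blast
  qed
  then have "z n = x n" for n
    using nth_map_upt[of n "Suc n" 0] by (metis subsequence_def add_0 diff_zero lessI)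
  then show "z = x" by blast
qed

end

theory Submission
  imports Defs
begin

text \<open>
  A point of the cover above \<open>x\<close> is of one of two kinds. Either all its coordinates have exactly one past;
  these pasts then fit together to a left-infinite history of \<open>x\<close>, and since \<open>X\<close> has no isolated points,
  every history of \<open>x\<close> arises in this way. Or some coordinate has two pasts. They merge at the branch
  point \<open>\<omega>\<close>, and the place where they merge determines the tail of the word, so the coordinate is a
  single word in the orbit of \<open>\<omega>\<close> and the point is its image under the section. Points of the second kind
  are therefore isolated, whereas those of the first kind are limits of the section. As the two
  preimages of \<open>\<omega>\<close> have a unique history each, \<open>x\<close> has two histories on the forward orbit of \<open>\<omega>\<close> and one
  elsewhere. For a Sturmian subshift, \<open>\<omega>\<close> is the itinerary of \<open>\<alpha>\<close>.
\<close>

section \<open>Prefixes and shifts of words\<close>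

lemma prefix_eq_iff: "prefix k x = prefix k y \<longleftrightarrow> (\<forall>i<k. x i = y i)"
  by (auto simp: subsequence_def)

lemma prefix_suffix_eqI:
  assumes "prefix l e = prefix l f" "suffix l e = suffix l f"
  shows "e = f"
  using assms prefix_suffix[of e l] prefix_suffix[of f l] by simp

lemma prefix_eq_mono:
  assumes "prefix l x = prefix l y" "k \<le> l"
  shows "prefix k x = prefix k y"
  using assms by (auto simp: prefix_eq_iff)

lemma prefix_suffix_eq:
  assumes "prefix l x = prefix l y" "m + k \<le> l"
  shows "prefix k (suffix m x) = prefix k (suffix m y)"
  using assms unfolding prefix_eq_iff by auto

lemma prefix_Suc_eq_iff: "prefix (Suc n) x = prefix (Suc n) y \<longleftrightarrow> x 0 = y 0 \<and> prefix n (suffix 1 x) = prefix n (suffix 1 y)"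
  unfolding prefix_eq_iff by (auto simp: less_Suc_eq_0_disj)

lemma suffix_build [simp]: "suffix (Suc 0) (a ## x) = x"
  by (rule ext) simp

lemma prefix_build_eq_iff:
  "prefix (Suc n) y = prefix (Suc n) (a ## x) \<longleftrightarrow> y 0 = a \<and> prefix n (suffix 1 y) = prefix n x"
  unfolding prefix_Suc_eq_iff[of y] by (simp only: One_nat_def suffix_build build.simps(1))

section \<open>Pasts and histories\<close>

text \<open>A past \<open>\<mu>\<close> of \<open>x\<close> is represented by the whole infinite
  word \<open>\<mu> x\<close>, so that the merging of pasts can be expressed through shifts instead
  of list concatenation.\<close>

definition ancestors :: "(nat \<Rightarrow> 'a) set \<Rightarrow> nat \<Rightarrow> (nat \<Rightarrow> 'a) \<Rightarrow> (nat \<Rightarrow> 'a) set" where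
  "ancestors X l x = {e \<in> X. suffix l e = x}"

lemma pasts_eq: "pasts X l x = prefix l ` ancestors X l x"
proof -
  have "\<mu> \<in> prefix l ` ancestors X l x" if "\<mu> \<in> pasts X l x" for \<mu>
  proof
    show "conc \<mu> x \<in> ancestors X l x" "\<mu> = prefix l (conc \<mu> x)"
      using that by (auto simp: ancestors_def pasts_def)
  qed
  moreover have "prefix l e \<in> pasts X l x" if "e \<in> ancestors X l x" for e
    using that prefix_suffix[of e l] by (auto simp: ancestors_def pasts_def)
  ultimately show ?thesis by blast
qed

lemma inj_on_prefix_ancestors: "inj_on (prefix l) (ancestors X l x)"
  by (rule inj_onI, rule prefix_suffix_eqI) (auto simp: ancestors_def)

lemma pasts_eq_singleton_iff:
  "pasts X l x = {w} \<longleftrightarrow> (\<exists>e. ancestors X l x = {e} \<and> prefix l e = w)"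
proof
  assume w: "pasts X l x = {w}"
  then obtain e where e: "e \<in> ancestors X l x" "prefix l e = w"
    unfolding pasts_eq by blast
  moreover have "f = e" if "f \<in> ancestors X l x" for f
    using inj_on_prefix_ancestors e that w unfolding pasts_eq by (metis imageI inj_onD singletonD)
  ultimately show "\<exists>e. ancestors X l x = {e} \<and> prefix l e = w" by blast
qed (auto simp: pasts_eq)

text \<open>A history of \<open>x\<close> encodes a two-sided sequence with right half \<open>x\<close>: \<open>h n\<close> is its part from
  position \<open>-n\<close> on.\<close>

definition histories :: "(nat \<Rightarrow> 'a) set \<Rightarrow> (nat \<Rightarrow> 'a) \<Rightarrow> (nat \<Rightarrow> nat \<Rightarrow> 'a) set" where
  "histories X x = {h. h 0 = x \<and> (\<forall>n. h n \<in> X \<and> suffix 1 (h (Suc n)) = h n)}"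

lemma suffix_history:
  assumes "h \<in> histories X x" "m \<le> n"
  shows "suffix m (h n) = h (n - m)"
  using assms(2)
proof (induction m)
  case (Suc m)
  have "suffix (Suc m) (h n) = suffix 1 (suffix m (h n))" by simp
  also have "\<dots> = suffix 1 (h (n - m))" using Suc by (simp only: Suc_leD)
  also have "\<dots> = suffix 1 (h (Suc (n - Suc m)))" using Suc.prems by (simp only: Suc_diff_Suc Suc_le_eq)
  also have "\<dots> = h (n - Suc m)" using assms(1) unfolding histories_def by blast
  finally show ?case .
qed simp

text \<open>The first step to the left picks a preimage \<open>y\<close>, and the rest is a history
  of \<open>y\<close>; \<open>case_nat x\<close> puts \<open>x\<close> back in front. This lets
  histories be counted along the forward orbit.\<close>

lemma histories_unfold:
  assumes "x \<in> X"
  shows "histories X x = (\<Union>y \<in> ancestors X 1 x. case_nat x ` histories X y)"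
proof (intro equalityI subsetI)
  fix h assume h: "h \<in> histories X x"
  then have "h \<circ> Suc \<in> histories X (h 1)" "h 1 \<in> ancestors X 1 x" "h = case_nat x (h \<circ> Suc)"
    by (auto simp: histories_def ancestors_def fun_eq_iff split: nat.split)
  then show "h \<in> (\<Union>y \<in> ancestors X 1 x. case_nat x ` histories X y)" by blast
next
  fix h assume "h \<in> (\<Union>y \<in> ancestors X 1 x. case_nat x ` histories X y)"
  then obtain y g where y: "y \<in> ancestors X 1 x" "g \<in> histories X y" "h = case_nat x g" by blast
  then show "h \<in> histories X x"
    using assms by (auto simp: histories_def ancestors_def split: nat.split)
qed

lemma inj_case_nat: "inj (case_nat x)"
  by (rule injI) (metis old.nat.simps(5) ext)

text \<open>The window of \<open>h\<close> used here covers the positions from \<open>k - l\<close>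
  to \<open>k - 1\<close>. Its last \<open>k\<close> letters lie in the right half, so the single
  condition on pasts also fixes the first \<open>k\<close> letters of \<open>y\<close>.\<close>

definition history_point ::
  "(nat \<Rightarrow> 'a) set \<Rightarrow> (nat \<Rightarrow> nat \<Rightarrow> 'a) \<Rightarrow> nat \<times> nat \<Rightarrow> (nat \<Rightarrow> 'a) set" where
  "history_point X h = (\<lambda>(k, l)\<in>cover_index.
     {y \<in> X. pasts X l (suffix k y) = {prefix l (h (l - k))}})"

section \<open>Points and open sets of the cover\<close>

text \<open>In terms of \<open>k\<close> and \<open>l - k\<close> the index order is a product
  order, so the maxima of both quantities give an upper bound.\<close>

lemma ex_upper_index:
  assumes "finite F"
  shows "\<exists>j\<in>cover_index. \<forall>i\<in>F \<inter> cover_index. index_le i j"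
proof -
  obtain K where K: "\<And>i. i \<in> F \<Longrightarrow> fst i \<le> K"
    using assms by (metis Max_ge finite_imageI imageI)
  obtain M where M: "\<And>i. i \<in> F \<Longrightarrow> snd i - fst i \<le> M"
    using assms Max_ge[of "(\<lambda>i. snd i - fst i) ` F"] by (meson finite_imageI imageI)
  have "(K, K + M) \<in> cover_index" by (simp add: cover_index_def)
  moreover have "index_le i (K, K + M)" if "i \<in> F" for i
    using K[OF that] M[OF that] by (cases i) (auto simp: index_le_def)
  ultimately show ?thesis by blast
qed

lemma cover_coordinate:
  assumes "p \<in> cover X" "i \<in> cover_index"
  shows "p i \<noteq> {}" "p i \<subseteq> X" "\<And>y. y \<in> p i \<Longrightarrow> p i = past_class X i y"
proof -
  have "p i \<in> X // past_rel X i" using assms by (auto simp: cover_def class_space_def)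
  then obtain x where x: "x \<in> X" "p i = past_rel X i `` {x}" by (rule quotientE)
  have eq: "equiv X (past_rel X i)" by (rule equiv_past_rel)
  show "p i \<noteq> {}" using x eq by (metis equiv_class_self empty_iff)
  show "p i \<subseteq> X" using x eq by (auto simp: equiv_def past_rel_def split: prod.splits)
  show "p i = past_class X i y" if "y \<in> p i" for y
    using that x eq unfolding past_class_def by (metis Image_singleton_iff equiv_class_eq)
qed

text \<open>Each word lies in its own class, so bonding only enlarges a class. Compatibility of
  coordinates can therefore be read as inclusion of sets.\<close>

lemma cover_antimono:
  assumes p: "p \<in> cover X" and ij: "i \<in> cover_index" "j \<in> cover_index" "index_le i j"
  shows "p j \<subseteq> p i"
proof
  fix y assume y: "y \<in> p j"
  then have "y \<in> X" using cover_coordinate(2)[OF p ij(2)] by blast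
  then have "(y, y) \<in> past_rel X i" using equiv_past_rel by (metis equiv_class_eq_iff)
  then have "y \<in> bond X i (p j)" using y by (auto simp: bond_def)
  then show "y \<in> p i" using p ij by (auto simp: cover_def)
qed

text \<open>Converse reading: bonding collects the \<open>i\<close>-classes of the words in
  \<open>p j\<close>, and by the inclusion each of them is \<open>p i\<close>.\<close>

lemma coverI:
  assumes ext: "p \<in> extensional cover_index"
    and ne: "\<And>i. i \<in> cover_index \<Longrightarrow> p i \<noteq> {}"
    and cls: "\<And>i y. i \<in> cover_index \<Longrightarrow> y \<in> p i \<Longrightarrow> y \<in> X \<and> p i = past_class X i y"
    and anti: "\<And>i j. i \<in> cover_index \<Longrightarrow> j \<in> cover_index \<Longrightarrow> index_le i j \<Longrightarrow> p j \<subseteq> p i"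
  shows "p \<in> cover X"
proof -
  have "p i \<in> class_space X i" if "i \<in> cover_index" for i
    using ne[OF that] cls[OF that] by (metis class_space_def ex_in_conv past_class_def quotientI)
  moreover have "bond X i (p j) = p i"
    if ij: "i \<in> cover_index" "j \<in> cover_index" "index_le i j" for i j
  proof -
    have "bond X i (p j) = (\<Union>y\<in>p j. past_class X i y)" by (auto simp: bond_def past_class_def)
    also have "\<dots> = (\<Union>y\<in>p j. p i)" using cls[OF ij(1)] anti[OF ij] by (intro SUP_cong) blast+
    finally show ?thesis using ne[OF ij(2)] by simp
  qed
  ultimately show ?thesis using ext by (auto simp: cover_def PiE_def)
qed

lemma openin_coordinate:
  assumes i: "i \<in> cover_index"
  shows "openin (cover_topology X) {q \<in> cover X. q i = A}"
proof -
  have "openin (product_topology (\<lambda>i. discrete_topology (class_space X i)) cover_index)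
      {q \<in> topspace (product_topology (\<lambda>i. discrete_topology (class_space X i)) cover_index).
        q i \<in> {A} \<inter> class_space X i}"
    using continuous_map_product_projection[OF i, of "\<lambda>i. discrete_topology (class_space X i)"]
    by (rule openin_continuous_map_preimage) simp
  moreover have "{q \<in> cover X. q i = A} =
      {q \<in> topspace (product_topology (\<lambda>i. discrete_topology (class_space X i)) cover_index).
        q i \<in> {A} \<inter> class_space X i} \<inter> cover X"
    using i by (auto simp: cover_def)
  ultimately show ?thesis unfolding cover_topology_def openin_subtopology by blast
qed

text \<open>A basic open set restricts finitely many coordinates. All of them are determined by the
  coordinate at a common upper bound \<open>j\<close>, so cylinders over one coordinate form a
  neighbourhood base.\<close>

lemma open_contains_coordinate:
  assumes U: "openin (cover_topology X) U" and p: "p \<in> U"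
  obtains j where "j \<in> cover_index" "\<And>q. q \<in> cover X \<Longrightarrow> q j = p j \<Longrightarrow> q \<in> U"
proof -
  have pc: "p \<in> cover X" using openin_subset[OF U] p by (auto simp: topspace_cover_topology)
  obtain T where T: "openin (product_topology (\<lambda>i. discrete_topology (class_space X i)) cover_index) T"
    "U = T \<inter> cover X"
    using U unfolding cover_topology_def openin_subtopology by blast
  have "\<exists>V. finite {i \<in> cover_index. V i \<noteq> topspace (discrete_topology (class_space X i))} \<and>
      (\<forall>i\<in>cover_index. openin (discrete_topology (class_space X i)) (V i)) \<and>
      p \<in> Pi\<^sub>E cover_index V \<and> Pi\<^sub>E cover_index V \<subseteq> T"
    using T(1)[unfolded openin_product_topology_alt] by (rule bspec) (use p T(2) in simp)
  then obtain V where V: "finite {i \<in> cover_index. V i \<noteq> topspace (discrete_topology (class_space X i))}"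
    "p \<in> Pi\<^sub>E cover_index V" "Pi\<^sub>E cover_index V \<subseteq> T"
    by (elim exE conjE)
  obtain j where j: "j \<in> cover_index"
    "\<And>i. i \<in> cover_index \<Longrightarrow> V i \<noteq> class_space X i \<Longrightarrow> index_le i j"
    using ex_upper_index[OF V(1)] by auto
  have "q \<in> U" if q: "q \<in> cover X" "q j = p j" for q
  proof -
    have "q i \<in> V i" if i: "i \<in> cover_index" for i
    proof (cases "V i = class_space X i")
      case True
      then show ?thesis using q(1) i by (auto simp: cover_def)
    next
      case False
      then have "index_le i j" using i j(2) by blast
      then have "bond X i (q j) = q i" "bond X i (p j) = p i"
        using q(1) pc i j(1) by (simp_all add: cover_def)
      then have "q i = p i" using q(2) by simp
      then show ?thesis using V(2) i by auto
    qed
    moreover have "q \<in> extensional cover_index" using q(1) by (auto simp: cover_def PiE_def)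
    ultimately show ?thesis using V(3) T(2) q(1) by (auto simp: PiE_def)
  qed
  then show ?thesis using that j(1) by blast
qed

section \<open>Shift spaces with a single aperiodic branch point\<close>

text \<open>What the fibre count needs from the Sturmian case: \<open>closed\<close> is topological
  closedness expressed by prefixes, \<open>perfect\<close> excludes isolated words, and
  \<open>aperiodic\<close> keeps the preimages of \<open>\<omega>\<close> off its forward
  orbit.\<close>

locale branching_shift =
  fixes X :: "(nat \<Rightarrow> 'a) set" and \<omega> :: "nat \<Rightarrow> 'a"
  assumes closed: "(\<And>n. \<exists>y\<in>X. prefix n y = prefix n x) \<Longrightarrow> x \<in> X"
    and shift: "suffix 1 ` X = X"
    and perfect: "x \<in> X \<Longrightarrow> infinite {y \<in> X. prefix n y = prefix n x}"
    and branch_in: "\<omega> \<in> X"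
    and card_preimages: "x \<in> X \<Longrightarrow> card (ancestors X 1 x) = (if x = \<omega> then 2 else 1)"
    and aperiodic: "suffix m \<omega> = suffix n \<omega> \<Longrightarrow> m = n"
begin

section \<open>Ancestors and the branch point\<close>

lemma suffix_in: "x \<in> X \<Longrightarrow> suffix n x \<in> X"
  using suffix_closed[OF shift] .

lemma ex_ancestor:
  assumes "x \<in> X"
  obtains e where "e \<in> X" "suffix n e = x"
  using left_extension[OF shift assms, of n] by (metis suffix_conc_length)

lemma preimage_unique:
  assumes "y \<in> X" "z \<in> X" "suffix 1 y = suffix 1 z" "suffix 1 y \<noteq> \<omega>"
  shows "y = z"
proof -
  have "card (ancestors X 1 (suffix 1 y)) = 1"
    using card_preimages[OF suffix_in[OF assms(1)]] assms(4) by simp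
  then obtain e where "ancestors X 1 (suffix 1 y) = {e}" by (auto simp: card_1_singleton_iff)
  then have "y = e" "z = e" using assms by (auto simp: ancestors_def)
  then show ?thesis by simp
qed

text \<open>Let \<open>m\<close> be the last position at which the two words differ. Their common
  tail after \<open>m\<close> has two preimages, hence is \<open>\<omega>\<close>.\<close>

lemma merge_at_branch:
  assumes "e \<in> X" "f \<in> X" "e \<noteq> f" "suffix l e = suffix l f"
  obtains m where "m < l" "e m \<noteq> f m" "suffix (Suc m) e = suffix (Suc m) f" "suffix (Suc m) e = \<omega>"
proof -
  define n where "n = (LEAST n. suffix n e = suffix n f)"
  have n: "suffix n e = suffix n f" unfolding n_def using assms(4) by (rule LeastI)
  have "n \<le> l" unfolding n_def using assms(4) by (rule Least_le)
  have "n \<noteq> 0" using n assms(3) by (metis suffix_0)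
  then obtain m where m: "n = Suc m" using not0_implies_Suc by blast
  have ne: "suffix m e \<noteq> suffix m f" using not_less_Least[of m "\<lambda>n. suffix n e = suffix n f"]
    unfolding n_def[symmetric] m by simp
  have "suffix (Suc m) e = \<omega>"
    using preimage_unique[of "suffix m e" "suffix m f"] n ne suffix_in assms unfolding m by auto
  moreover have "e m \<noteq> f m"
  proof
    assume eq: "e m = f m"
    have "suffix m e i = suffix m f i" for i
    proof (cases i)
      case (Suc i')
      then show ?thesis using fun_cong[OF n, of i'] unfolding m by simp
    qed (use eq in simp)
    then show False using ne by blast
  qed
  ultimately show ?thesis using that[of m] n \<open>n \<le> l\<close> unfolding m by simp
qed

text \<open>Two ancestors would merge in \<open>\<omega>\<close> at a position
  \<open>Suc m \<le> l\<close>, which makes \<open>x\<close> the shift of \<open>\<omega>\<close> by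
  \<open>l - Suc m < l\<close>.\<close>

lemma ancestors_singleton:
  assumes "x \<in> X" "\<And>j. j < l \<Longrightarrow> x \<noteq> suffix j \<omega>"
  shows "\<exists>e. ancestors X l x = {e}"
proof -
  obtain e where e: "e \<in> X" "suffix l e = x" by (rule ex_ancestor[OF assms(1)])
  have "f = e" if f: "f \<in> X" "suffix l f = x" for f
  proof (rule ccontr)
    assume "f \<noteq> e"
    then obtain m where m: "m < l" "suffix (Suc m) f = \<omega>"
      using merge_at_branch[of f e l] e f by metis
    have "x = suffix (l - Suc m) (suffix (Suc m) f)" using f(2) m(1) by simp
    then have "x = suffix (l - Suc m) \<omega>" unfolding m(2) .
    then show False using m(1) assms(2)[of "l - Suc m"] by simp
  qed
  then have "ancestors X l x = {e}" using e unfolding ancestors_def by blast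
  then show ?thesis by blast
qed

text \<open>The word \<open>suffix j \<omega>\<close> sees the branching \<open>j\<close> letters to
  its left. One more letter selects a preimage of \<open>\<omega>\<close>, and the remaining
  \<open>l - Suc j\<close> letters extend it arbitrarily.\<close>

lemma two_ancestors:
  assumes "j < l"
  obtains e f where "e \<in> ancestors X l (suffix j \<omega>)" "f \<in> ancestors X l (suffix j \<omega>)" "e \<noteq> f"
proof -
  have "card (ancestors X 1 \<omega>) = 2" using card_preimages[OF branch_in] by simp
  then obtain a b where ab: "ancestors X 1 \<omega> = {a, b}" "a \<noteq> b" by (auto simp: card_2_iff)
  then have "a \<in> ancestors X 1 \<omega>" "b \<in> ancestors X 1 \<omega>" by auto
  then have ab': "a \<in> X" "b \<in> X" "suffix 1 a = \<omega>" "suffix 1 b = \<omega>" by (auto simp: ancestors_def)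
  obtain e where e: "e \<in> X" "suffix (l - Suc j) e = a" by (rule ex_ancestor[OF ab'(1)])
  obtain f where f: "f \<in> X" "suffix (l - Suc j) f = b" by (rule ex_ancestor[OF ab'(2)])
  have "l = l - Suc j + 1 + j" using assms by simp
  then have "suffix l y = suffix j (suffix 1 (suffix (l - Suc j) y))" for y :: "nat \<Rightarrow> 'a"
    by (metis suffix_suffix)
  then have "suffix l e = suffix j \<omega>" "suffix l f = suffix j \<omega>" using e f ab' by metis+
  moreover have "e \<noteq> f" using e f ab by auto
  ultimately show ?thesis using that e f by (auto simp: ancestors_def)
qed

text \<open>Two pasts record by their letters the position \<open>m\<close> where they branch. The
  word \<open>y'\<close> has the same pasts and so branches at the same position, and the tail after
  a branching is always \<open>\<omega>\<close>. Thus both tails are the same shift of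
  \<open>\<omega>\<close>.\<close>

lemma past_rel_eq:
  assumes rel: "(y, y') \<in> past_rel X (k, l)"
    and ef: "e \<in> ancestors X l (suffix k y)" "f \<in> ancestors X l (suffix k y)" "e \<noteq> f"
  shows "y = y'"
proof -
  have pk: "prefix k y = prefix k y'"
    and ps: "prefix l ` ancestors X l (suffix k y) = prefix l ` ancestors X l (suffix k y')"
    using rel by (auto simp: past_rel_def pasts_eq)
  have ex: "\<exists>g'. g' \<in> ancestors X l (suffix k y') \<and> prefix l g' = prefix l g"
    if "g \<in> ancestors X l (suffix k y)" for g
  proof -
    have "prefix l g \<in> prefix l ` ancestors X l (suffix k y')" using that ps by blast
    then obtain g' where "prefix l g = prefix l g'" "g' \<in> ancestors X l (suffix k y')" by (rule imageE)
    then show ?thesis by (intro exI[of _ g']) simp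
  qed
  obtain e' where e': "e' \<in> ancestors X l (suffix k y')" "prefix l e' = prefix l e"
    using ex[OF ef(1)] by blast
  obtain f' where f': "f' \<in> ancestors X l (suffix k y')" "prefix l f' = prefix l f"
    using ex[OF ef(2)] by blast
  obtain m where m: "m < l" "e m \<noteq> f m" "suffix (Suc m) e = suffix (Suc m) f" "suffix (Suc m) e = \<omega>"
    using merge_at_branch[of e f l] ef by (auto simp: ancestors_def)
  have "e' m \<noteq> f' m" using m e' f' by (auto simp: prefix_eq_iff)
  then have "suffix m e' \<noteq> suffix m f'" by (metis add_0_right suffix_nth)
  \<comment> \<open>Up to \<open>l\<close> the primed words copy \<open>e\<close> and
    \<open>f\<close>, which agree after \<open>m\<close>; from \<open>l\<close> on both are
    \<open>suffix k y'\<close>.\<close>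
  moreover have "suffix (Suc m) e' = suffix (Suc m) f'"
  proof (rule prefix_suffix_eqI)
    have l: "Suc m + (l - Suc m) = l" using m by simp
    show "prefix (l - Suc m) (suffix (Suc m) e') = prefix (l - Suc m) (suffix (Suc m) f')"
      using prefix_suffix_eq[OF e'(2), of "Suc m" "l - Suc m"]
        prefix_suffix_eq[OF f'(2), of "Suc m" "l - Suc m"] m l by simp
    show "suffix (l - Suc m) (suffix (Suc m) e') = suffix (l - Suc m) (suffix (Suc m) f')"
      using e' f' l by (simp add: ancestors_def)
  qed
  ultimately have "suffix (Suc m) e' = \<omega>"
    using preimage_unique[of "suffix m e'" "suffix m f'"] suffix_in e' f' by (auto simp: ancestors_def)
  then have "suffix l e' = suffix l e"
    using m by (metis Suc_leI le_add_diff_inverse suffix_suffix)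
  then have "suffix k y = suffix k y'" using e' ef by (auto simp: ancestors_def)
  then show ?thesis using prefix_suffix_eqI[OF pk] by blast
qed

section \<open>Points of the cover given by histories\<close>

text \<open>The word \<open>y\<close> itself extends to the left by \<open>l - k\<close> letters;
  this extension is an ancestor of \<open>suffix k y\<close>, so it must be the only one.\<close>

lemma history_point_iff:
  assumes h: "h \<in> histories X x" and kl: "k \<le> l"
  shows "y \<in> history_point X h (k, l) \<longleftrightarrow>
    y \<in> X \<and> (\<exists>e. ancestors X l (suffix k y) = {e} \<and> suffix (l - k) e = y
      \<and> prefix l e = prefix l (h (l - k)))" (is "?L \<longleftrightarrow> ?R")
proof
  assume ?L
  then have y: "y \<in> X" and "pasts X l (suffix k y) = {prefix l (h (l - k))}"
    using kl by (auto simp: history_point_def cover_index_def)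
  then obtain e where e: "ancestors X l (suffix k y) = {e}" "prefix l e = prefix l (h (l - k))"
    by (auto simp: pasts_eq_singleton_iff)
  obtain f where f: "f \<in> X" "suffix (l - k) f = y" by (rule ex_ancestor[OF y])
  then have "f \<in> ancestors X l (suffix k y)" using kl by (auto simp: ancestors_def)
  then have "f = e" using e by simp
  then show ?R using y e f by blast
next
  assume ?R
  then show ?L using kl by (auto simp: history_point_def cover_index_def pasts_eq_singleton_iff)
qed

lemma history_point_prefix:
  assumes h: "h \<in> histories X x" and kl: "k \<le> l" and y: "y \<in> history_point X h (k, l)"
  shows "prefix k y = prefix k x"
proof -
  obtain e where e: "suffix (l - k) e = y" "prefix l e = prefix l (h (l - k))"
    using y history_point_iff[OF h kl] by blast
  have "prefix k (suffix (l - k) e) = prefix k (suffix (l - k) (h (l - k)))"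
    using e kl by (intro prefix_suffix_eq) auto
  moreover have "h 0 = x" using h by (simp add: histories_def)
  ultimately show ?thesis using e suffix_history[OF h, of "l - k" "l - k"] by simp
qed

text \<open>
  Infinitely many words extend a given finite piece of the history, and only those whose tail is one of
  the first \<open>l\<close> shifts of \<open>\<omega>\<close> have another past.
\<close>

lemma infinite_history_point:
  assumes h: "h \<in> histories X x" and kl: "k \<le> l"
  shows "infinite (history_point X h (k, l))"
proof -
  define E where "E = {e \<in> X. prefix l e = prefix l (h (l - k))}"
  define G where "G = {e \<in> E. \<forall>j<l. suffix l e \<noteq> suffix j \<omega>}"
  have inj: "inj_on (suffix l) E"
    by (rule inj_onI, rule prefix_suffix_eqI) (auto simp: E_def)
  have "infinite E" unfolding E_def using h by (intro perfect) (auto simp: histories_def)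
  moreover have "finite (E - G)"
  proof (rule inj_on_finite)
    show "inj_on (suffix l) (E - G)" using inj by (rule inj_on_subset) blast
    show "suffix l ` (E - G) \<subseteq> (\<lambda>j. suffix j \<omega>) ` {..<l}" by (auto simp: G_def)
  qed simp
  ultimately have "infinite G" by (metis Diff_infinite_finite Diff_Diff_Int G_def inf.absorb_iff2 mem_Collect_eq subsetI)
  moreover have "inj_on (suffix (l - k)) G"
  proof (rule inj_onI)
    fix e f assume ef: "e \<in> G" "f \<in> G" "suffix (l - k) e = suffix (l - k) f"
    then have "suffix k (suffix (l - k) e) = suffix k (suffix (l - k) f)" by simp
    then have "suffix l e = suffix l f" using kl by simp
    then show "e = f" using inj ef by (auto simp: G_def dest: inj_onD)
  qed
  ultimately have "infinite (suffix (l - k) ` G)" by (simp add: finite_image_iff)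
  moreover have "suffix (l - k) ` G \<subseteq> history_point X h (k, l)"
  proof clarify
    fix e assume e: "e \<in> G"
    then have eX: "e \<in> X" and pe: "prefix l e = prefix l (h (l - k))" by (auto simp: G_def E_def)
    have eq: "suffix k (suffix (l - k) e) = suffix l e" using kl by simp
    obtain f where "ancestors X l (suffix l e) = {f}"
      using ancestors_singleton[of "suffix l e" l] e suffix_in[OF eX] by (auto simp: G_def)
    moreover have "e \<in> ancestors X l (suffix l e)" using eX by (simp add: ancestors_def)
    ultimately have "ancestors X l (suffix l e) = {e}" by simp
    then show "suffix (l - k) e \<in> history_point X h (k, l)"
      using history_point_iff[OF h kl] suffix_in[OF eX] pe eq by auto
  qed
  ultimately show ?thesis using infinite_super by blast
qed

text \<open>Pasts of length \<open>l \<ge> k\<close> already contain the first \<open>k\<close>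
  letters, so the prefix condition in the class is automatic.\<close>

lemma history_point_class:
  assumes h: "h \<in> histories X x" and kl: "k \<le> l" and y: "y \<in> history_point X h (k, l)"
  shows "history_point X h (k, l) = past_class X (k, l) y"
proof -
  have mem: "z \<in> history_point X h (k, l) \<longleftrightarrow>
      z \<in> X \<and> pasts X l (suffix k z) = {prefix l (h (l - k))}" for z
    using kl by (auto simp: history_point_def cover_index_def)
  have "z \<in> history_point X h (k, l) \<longleftrightarrow> z \<in> past_class X (k, l) y" for z
    using y mem[of z] mem[of y] history_point_prefix[OF h kl] 
    by (auto simp: past_class_def past_rel_def)
  then show ?thesis by blast
qed

text \<open>Uniqueness passes from the larger to the smaller index: an ancestor for the smaller one,
  lengthened to the left by \<open>d\<close> letters and cut \<open>k2 - k1\<close> letters further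
  to the right, is an ancestor for the larger one.\<close>

lemma history_point_antimono:
  assumes h: "h \<in> histories X x" and le: "k1 \<le> l1" "k2 \<le> l2" "k1 \<le> k2" "l1 - k1 \<le> l2 - k2"
  shows "history_point X h (k2, l2) \<subseteq> history_point X h (k1, l1)"
proof
  fix y assume "y \<in> history_point X h (k2, l2)"
  then obtain e where y: "y \<in> X"
    and e: "ancestors X l2 (suffix k2 y) = {e}" "suffix (l2 - k2) e = y"
      "prefix l2 e = prefix l2 (h (l2 - k2))"
    using history_point_iff[OF h le(2)] by auto
  \<comment> \<open>The window of the larger index starts \<open>d\<close> positions further to the
    left.\<close>
  define d where "d = (l2 - k2) - (l1 - k1)"
  have eX: "e \<in> X" using e(1) by (auto simp: ancestors_def)
  have d: "d + (l1 - k1) = l2 - k2" "d + l1 + (k2 - k1) = l2" "d \<le> l2 - k2" "l2 - k2 - d = l1 - k1"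
    using le by (auto simp: d_def)
  have sy: "suffix (l1 - k1) (suffix d e) = y" using e(2) d by simp
  then have "suffix k1 (suffix (l1 - k1) (suffix d e)) = suffix k1 y" by simp
  then have mem: "suffix d e \<in> ancestors X l1 (suffix k1 y)"
    using le suffix_in[OF eX] by (simp add: ancestors_def add.assoc)
  have "f = suffix d e" if f: "f \<in> ancestors X l1 (suffix k1 y)" for f
  proof -
    obtain g where g: "g \<in> X" "suffix d g = f"
      using f ex_ancestor[of f d] by (auto simp: ancestors_def)
    have "suffix l2 g = suffix (k2 - k1) (suffix l1 (suffix d g))" using d by (simp add: add.assoc)
    also have "\<dots> = suffix (k2 - k1) (suffix k1 y)" using f g by (simp add: ancestors_def)
    also have "\<dots> = suffix k2 y" using le by simp
    finally have "g \<in> ancestors X l2 (suffix k2 y)" using g by (simp add: ancestors_def)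
    then show ?thesis using e g by auto
  qed
  then have "ancestors X l1 (suffix k1 y) = {suffix d e}" using mem by blast
  moreover have "prefix l1 (suffix d e) = prefix l1 (suffix d (h (l2 - k2)))"
    using e(3) d by (intro prefix_suffix_eq) auto
  ultimately show "y \<in> history_point X h (k1, l1)"
    using history_point_iff[OF h le(1)] y sy suffix_history[OF h d(3)] d(4) by auto
qed

lemma history_point_in_cover:
  assumes h: "h \<in> histories X x"
  shows "history_point X h \<in> cover X"
proof (rule coverI)
  show "history_point X h \<in> extensional cover_index" by (auto simp: history_point_def)
next
  fix i assume i: "i \<in> cover_index"
  then obtain k l where kl: "i = (k, l)" "k \<le> l" by (auto simp: cover_index_def)
  show "history_point X h i \<noteq> {}" using infinite_history_point[OF h kl(2)] kl(1) by auto
  show "y \<in> X \<and> history_point X h i = past_class X i y" if "y \<in> history_point X h i" for y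
    using history_point_class[OF h kl(2)] history_point_iff[OF h kl(2)] that kl(1) by auto
next
  fix i j assume "i \<in> cover_index" "j \<in> cover_index" "index_le i j"
  then show "history_point X h j \<subseteq> history_point X h i"
    using history_point_antimono[OF h, of "fst i" "snd i" "fst j" "snd j"]
    by (simp add: cover_index_def index_le_def case_prod_beta)
qed

section \<open>The projection to the shift space\<close>

text \<open>The base point is built as a limit of words chosen from the diagonal coordinates
  \<open>(n, n)\<close>, whose prefixes are consistent; it lies in \<open>X\<close> by closedness.
  This justifies the definite description in \<open>cover_proj\<close>.\<close>

lemma cover_proj_props:
  assumes p: "p \<in> cover X"
  shows "cover_proj X p \<in> X"
    and "\<And>k l y. k \<le> l \<Longrightarrow> y \<in> p (k, l) \<Longrightarrow> prefix k y = prefix k (cover_proj X p)"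
proof -
  define c where "c n = (SOME y. y \<in> p (n, n))" for n
  have ci: "(k, l) \<in> cover_index \<longleftrightarrow> k \<le> l" for k l by (simp add: cover_index_def)
  have c: "c n \<in> p (n, n)" for n
    unfolding c_def using cover_coordinate(1)[OF p, of "(n, n)"] by (simp add: ci some_in_eq)
  have agree: "prefix k y = prefix k (c k)" if "k \<le> l" "y \<in> p (k, l)" for k l y
  proof -
    have "y \<in> p (k, k)"
      using cover_antimono[OF p, of "(k, k)" "(k, l)"] that by (auto simp: ci index_le_def)
    then have "c k \<in> past_class X (k, k) y"
      using c[of k] cover_coordinate(3)[OF p, of "(k, k)"] by (auto simp: ci)
    then show ?thesis by (auto simp: past_class_def past_rel_def)
  qed
  have c_agree: "prefix k (c n) = prefix k (c k)" if "k \<le> n" for k n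
    using that agree[of k n "c n"] c[of n] cover_antimono[OF p, of "(k, k)" "(n, n)"] agree[of k k "c n"]
    by (auto simp: ci index_le_def)
  \<comment> \<open>The coordinate \<open>(Suc n, Suc n)\<close> is the first diagonal one that
    fixes letter \<open>n\<close>.\<close>
  define x where "x n = c (Suc n) n" for n
  have x: "prefix k x = prefix k (c k)" for k
    using c_agree by (auto simp: prefix_eq_iff x_def) (metis Suc_leI lessI)
  have cX: "c n \<in> X" for n using c[of n] cover_coordinate(2)[OF p, of "(n, n)"] by (auto simp: ci)
  have "x \<in> X" by (rule closed) (use x cX in metis)
  have "cover_proj X p = x"
    unfolding cover_proj_def
  proof (rule the_equality)
    show "x \<in> X \<and> (\<forall>(k, l)\<in>cover_index. \<forall>y\<in>p (k, l). prefix k x = prefix k y)"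
      using \<open>x \<in> X\<close> agree x by (auto simp: ci)
  next
    fix z assume z: "z \<in> X \<and> (\<forall>(k, l)\<in>cover_index. \<forall>y\<in>p (k, l). prefix k z = prefix k y)"
    have "prefix k z = prefix k x" for k using z c[of k] x[of k] ci[of k k] by fastforce
    then show "z = x" unfolding prefix_eq_iff by blast
  qed
  then show "cover_proj X p \<in> X"
    and "\<And>k l y. k \<le> l \<Longrightarrow> y \<in> p (k, l) \<Longrightarrow> prefix k y = prefix k (cover_proj X p)"
    using \<open>x \<in> X\<close> agree x by auto
qed

lemma cover_proj_history_point:
  assumes h: "h \<in> histories X x"
  shows "cover_proj X (history_point X h) = x"
proof -
  have "prefix k (cover_proj X (history_point X h)) = prefix k x" for k
  proof -
    have "history_point X h (k, k) \<noteq> {}" using infinite_history_point[OF h, of k k] by auto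
    then obtain y where y: "y \<in> history_point X h (k, k)" by blast
    then show ?thesis
      using history_point_prefix[OF h, of k k] cover_proj_props(2)[OF history_point_in_cover[OF h], of k k]
      by simp
  qed
  then show ?thesis unfolding prefix_eq_iff by blast
qed

text \<open>Any word in the coordinate \<open>(k, k + m)\<close> has as its only past the first
  \<open>k + m\<close> letters of \<open>h m\<close>. As \<open>k\<close> grows this recovers all of
  \<open>h m\<close>.\<close>

lemma inj_on_history_point: "inj_on (history_point X) (histories X x)"
proof (rule inj_onI)
  fix h g assume h: "h \<in> histories X x" and g: "g \<in> histories X x"
    and eq: "history_point X h = history_point X g"
  have "prefix (k + m) (h m) = prefix (k + m) (g m)" for k m
  proof -
    have "history_point X h (k, k + m) \<noteq> {}" using infinite_history_point[OF h, of k "k + m"] by auto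
    then obtain y where "y \<in> history_point X h (k, k + m)" "y \<in> history_point X g (k, k + m)"
      using eq by auto
    then have "pasts X (k + m) (suffix k y) = {prefix (k + m) (h m)}"
      "pasts X (k + m) (suffix k y) = {prefix (k + m) (g m)}"
      by (simp_all add: history_point_def cover_index_def)
    then show ?thesis by simp
  qed
  then have "h m i = g m i" for m i
    unfolding prefix_eq_iff by (metis less_add_Suc1 trans_less_add1)
  then show "h = g" by blast
qed

section \<open>Two kinds of points of the cover\<close>

lemma orb_coordinate:
  assumes "x \<in> orb X \<omega>"
  obtains k l e f where "k \<le> l" "e \<in> ancestors X l (suffix k x)" "f \<in> ancestors X l (suffix k x)" "e \<noteq> f"
proof -
  obtain j k where jk: "suffix k x = suffix j \<omega>" using assms by (auto simp: orb_def)
  \<comment> \<open>The length must be at least \<open>k\<close> for an index and exceed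
    \<open>j\<close> for the branching at \<open>\<omega>\<close> to be visible.\<close>
  define l where "l = max k (Suc j)"
  obtain e f where "e \<in> ancestors X l (suffix j \<omega>)" "f \<in> ancestors X l (suffix j \<omega>)" "e \<noteq> f"
    by (rule two_ancestors[of j l]) (simp add: l_def)
  then show ?thesis using that[of k l e f] jk by (simp add: l_def)
qed

lemma orbI:
  assumes "y \<in> X" "e \<in> ancestors X l (suffix k y)" "f \<in> ancestors X l (suffix k y)" "e \<noteq> f"
  shows "y \<in> orb X \<omega>"
proof -
  obtain m where "m < l" "suffix (Suc m) e = \<omega>"
    using merge_at_branch[of e f l] assms by (metis (mono_tags, lifting) ancestors_def mem_Collect_eq)
  then have "suffix (l - Suc m) \<omega> = suffix l e" by auto
  then have "suffix k y = suffix (l - Suc m) \<omega>" using assms by (simp add: ancestors_def)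
  then show ?thesis using assms(1) by (auto simp: orb_def)
qed

text \<open>Some coordinate of the section at an orbit point has two pasts, whereas every coordinate
  of a history point has only one.\<close>

lemma section_neq_history_point:
  assumes x: "x \<in> orb X \<omega>" and h: "h \<in> histories X z"
  shows "cover_section X x \<noteq> history_point X h"
proof
  assume eq: "cover_section X x = history_point X h"
  obtain k l e f where kl: "k \<le> l" and ef: "e \<in> ancestors X l (suffix k x)"
    "f \<in> ancestors X l (suffix k x)" "e \<noteq> f"
    by (rule orb_coordinate[OF x])
  have "x \<in> X" using x by (auto simp: orb_def)
  then have "x \<in> cover_section X x (k, l)"
    using kl by (auto simp: cover_section_def cover_index_def past_class_def past_rel_def)
  then show False using eq history_point_iff[OF h kl] ef by auto
qed

text \<open>By \<open>past_rel_eq\<close> the coordinate \<open>(k, l)\<close> is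
  \<open>{y}\<close>. Every index has a common upper bound with \<open>(k, l)\<close>, and the
  nonempty coordinate there lies in both, so \<open>y\<close> belongs to every coordinate.\<close>

lemma cover_determined:
  assumes p: "p \<in> cover X" and kl: "k \<le> l" and y: "y \<in> p (k, l)"
    and ef: "e \<in> ancestors X l (suffix k y)" "f \<in> ancestors X l (suffix k y)" "e \<noteq> f"
  shows "p = cover_section X y"
proof -
  have ci: "(k, l) \<in> cover_index" using kl by (simp add: cover_index_def)
  have single: "p (k, l) = {y}"
  proof -
    have "p (k, l) = past_class X (k, l) y" using cover_coordinate(3)[OF p ci y] .
    then show ?thesis using y past_rel_eq[OF _ ef] by (auto simp: past_class_def)
  qed
  have "y \<in> p i" if i: "i \<in> cover_index" for i
  proof -
    obtain j where j: "j \<in> cover_index" "index_le i j" "index_le (k, l) j"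
      using ex_upper_index[of "{i, (k, l)}"] i ci by auto
    then have "p j \<subseteq> p i" "p j \<subseteq> {y}" "p j \<noteq> {}"
      using cover_antimono[OF p] cover_coordinate(1)[OF p] i ci single by metis+
    then show ?thesis by blast
  qed
  then have "p i = past_class X i y" if "i \<in> cover_index" for i
    using cover_coordinate(3)[OF p that] that by blast
  moreover have "p \<in> extensional cover_index" using p by (auto simp: cover_def PiE_def)
  ultimately show ?thesis by (auto simp: cover_section_def extensional_def fun_eq_iff)
qed

text \<open>For fixed \<open>m\<close> the unique ancestors in the coordinates
  \<open>(k, k + m)\<close> agree on longer and longer prefixes as \<open>k\<close> grows. Their
  limit is the part of the history from position \<open>-m\<close> on, and passing from
  \<open>m\<close> to \<open>Suc m\<close> adds one letter on the left.\<close>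

lemma cover_history:
  assumes p: "p \<in> cover X"
    and unique: "\<And>k l y. k \<le> l \<Longrightarrow> y \<in> p (k, l) \<Longrightarrow> \<exists>e. ancestors X l (suffix k y) = {e}"
  shows "\<exists>h\<in>histories X (cover_proj X p). p = history_point X h"
proof -
  have ci: "(k, l) \<in> cover_index \<longleftrightarrow> k \<le> l" for k l by (simp add: cover_index_def)
  have pX: "y \<in> X" if "k \<le> l" "y \<in> p (k, l)" for k l y
    using cover_coordinate(2)[OF p, of "(k, l)"] that by (auto simp: ci)
  have anc: "\<exists>e. ancestors X (k + m) (suffix k y) = {e} \<and> suffix m e = y" if y: "y \<in> p (k, k + m)" for k m y
  proof -
    obtain e where e: "ancestors X (k + m) (suffix k y) = {e}" using unique[OF _ y] by auto
    obtain f where f: "f \<in> X" "suffix m f = y" using ex_ancestor[OF pX[OF _ y]] by auto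
    then have "f \<in> ancestors X (k + m) (suffix k y)" by (auto simp: ancestors_def add.commute)
    then show ?thesis using e f by auto
  qed
  define c where "c m k = (SOME y. y \<in> p (k, k + m))" for m k
  have c: "c m k \<in> p (k, k + m)" for m k
    unfolding c_def using cover_coordinate(1)[OF p, of "(k, k + m)"] by (simp add: ci some_in_eq)
  define E where "E m k = the_elem (ancestors X (k + m) (suffix k (c m k)))" for m k
  \<comment> \<open>Words in one class have equal pasts, so this prefix does not depend on the
    chosen representative.\<close>
  have E: "prefix (k + m) (E m k) = prefix (k + m) e"
    if "y \<in> p (k, k + m)" "ancestors X (k + m) (suffix k y) = {e}" for m k y e
  proof -
    have "c m k \<in> past_class X (k, k + m) y"
      using c[of m k] cover_coordinate(3)[OF p, of "(k, k + m)"] that by (auto simp: ci)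
    then have "pasts X (k + m) (suffix k (c m k)) = {prefix (k + m) e}"
      using that(2) unfolding pasts_eq by (auto simp: past_class_def past_rel_def pasts_eq)
    then obtain f where "ancestors X (k + m) (suffix k (c m k)) = {f}" "prefix (k + m) f = prefix (k + m) e"
      by (auto simp: pasts_eq_singleton_iff)
    then show ?thesis by (simp add: E_def)
  qed
  have EX: "E m k \<in> X" for m k
  proof -
    obtain e where "ancestors X (k + m) (suffix k (c m k)) = {e}" using anc[OF c] by blast
    moreover from this have "e \<in> X" unfolding ancestors_def by blast
    ultimately show ?thesis by (simp add: E_def)
  qed
  \<comment> \<open>The representative \<open>c m n\<close> also lies in the coordinate
    \<open>(k, k + m)\<close>, and its left extension by \<open>m\<close> letters is the unique
    ancestor at both indices.\<close>
  have E_mono: "prefix (k + m) (E m n) = prefix (k + m) (E m k)" if "k \<le> n" for k m n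
  proof -
    have cn: "c m n \<in> p (k, k + m)"
      using cover_antimono[OF p, of "(k, k + m)" "(n, n + m)"] that c[of m n] by (auto simp: ci index_le_def)
    obtain e where e: "ancestors X (n + m) (suffix n (c m n)) = {e}" "suffix m e = c m n"
      using anc[OF c[of m n]] by blast
    then have "e \<in> X" by (auto simp: ancestors_def)
    then have "e \<in> ancestors X (k + m) (suffix k (c m n))"
      using e(2) by (simp add: ancestors_def add.commute flip: e(2))
    then have "ancestors X (k + m) (suffix k (c m n)) = {e}" using anc[OF cn] by auto
    then have "prefix (k + m) (E m k) = prefix (k + m) e" using E[OF cn] by blast
    moreover have "E m n = e" using e by (simp add: E_def)
    ultimately show ?thesis by simp
  qed
  \<comment> \<open>Dropping the leftmost letter of the ancestor for \<open>Suc m\<close> yields the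
    one for \<open>m\<close>.\<close>
  have E_Suc: "prefix (k + m) (suffix 1 (E (Suc m) k)) = prefix (k + m) (E m k)" for k m
  proof -
    have cn: "c (Suc m) k \<in> p (k, k + m)"
      using cover_antimono[OF p, of "(k, k + m)" "(k, k + Suc m)"] c[of "Suc m" k] by (auto simp: ci index_le_def)
    obtain e where e: "ancestors X (k + Suc m) (suffix k (c (Suc m) k)) = {e}" "suffix (Suc m) e = c (Suc m) k"
      using anc[OF c[of "Suc m" k]] by blast
    then have "e \<in> X" by (auto simp: ancestors_def)
    then have "suffix 1 e \<in> ancestors X (k + m) (suffix k (c (Suc m) k))"
      using suffix_in[of e 1] by (simp add: ancestors_def add.commute flip: e(2))
    then have "ancestors X (k + m) (suffix k (c (Suc m) k)) = {suffix 1 e}" using anc[OF cn] by auto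
    then have "prefix (k + m) (E m k) = prefix (k + m) (suffix 1 e)" using E[OF cn] by blast
    moreover have "E (Suc m) k = e" using e by (simp add: E_def)
    ultimately show ?thesis by simp
  qed
  \<comment> \<open>Letter \<open>i\<close> is stable once \<open>i < k + m\<close>; the choice
    \<open>k = Suc i\<close> achieves this for every \<open>m\<close>.\<close>
  define h where "h m i = E m (Suc i) i" for m i
  have h: "prefix (k + m) (h m) = prefix (k + m) (E m k)" for k m
    unfolding prefix_eq_iff
  proof (intro allI impI)
    fix i assume i: "i < k + m"
    show "h m i = E m k i"
    proof (cases "Suc i \<le> k")
      case True
      then show ?thesis using E_mono[of "Suc i" k m, unfolded prefix_eq_iff] by (simp add: h_def)
    next
      case False
      then show ?thesis using E_mono[of k "Suc i" m, unfolded prefix_eq_iff] i by (simp add: h_def)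
    qed
  qed
  have hX: "h m \<in> X" for m
  proof (rule closed)
    fix n show "\<exists>y\<in>X. prefix n y = prefix n (h m)"
      using EX[of m n] prefix_eq_mono[OF h[where k = n and m = m], of n] by force
  qed
  have hS: "suffix 1 (h (Suc m)) = h m" for m
  proof -
    have "prefix k (suffix 1 (h (Suc m))) = prefix k (h m)" for k
    proof -
      have "prefix (k + m) (suffix 1 (h (Suc m))) = prefix (k + m) (suffix 1 (E (Suc m) k))"
        by (rule prefix_suffix_eq[OF h[where k = k and m = "Suc m"]]) simp
      then have "prefix (k + m) (suffix 1 (h (Suc m))) = prefix (k + m) (h m)"
        using E_Suc h by simp
      then show ?thesis by (rule prefix_eq_mono) simp
    qed
    then show ?thesis unfolding prefix_eq_iff by blast
  qed
  have hist: "h \<in> histories X (h 0)" using hX hS by (simp add: histories_def)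
  have sub: "c m k \<in> history_point X h (k, k + m)" for k m
  proof -
    obtain e where e: "ancestors X (k + m) (suffix k (c m k)) = {e}" "suffix m e = c m k"
      using anc[OF c[of m k]] by blast
    moreover have "prefix (k + m) e = prefix (k + m) (h m)" using E[OF c e(1)] h by simp
    ultimately show ?thesis
      using history_point_iff[OF hist, of k "k + m"] pX[OF _ c[of m k]] by auto
  qed
  \<comment> \<open>Both sides are the class of the same representative.\<close>
  have "p (k, l) = history_point X h (k, l)" if kl: "k \<le> l" for k l
  proof -
    obtain m where m: "l = k + m" using kl le_iff_add by blast
    have "p (k, l) = past_class X (k, l) (c m k)"
      by (rule cover_coordinate(3)[OF p]) (use c[of m k] kl in \<open>simp_all add: m ci\<close>)
    moreover have "history_point X h (k, l) = past_class X (k, l) (c m k)"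
      by (rule history_point_class[OF hist kl]) (simp add: m sub)
    ultimately show ?thesis by simp
  qed
  moreover have "p \<in> extensional cover_index" using p by (auto simp: cover_def PiE_def)
  moreover have "history_point X h \<in> extensional cover_index" by (auto simp: history_point_def)
  ultimately have "p = history_point X h"
    by (intro extensionalityI[of p cover_index]) (auto simp: cover_index_def)
  moreover from this have "cover_proj X p = h 0" using cover_proj_history_point[OF hist] by simp
  ultimately show ?thesis using hist by auto
qed

lemma cover_cases:
  assumes p: "p \<in> cover X"
  obtains (orbit) x where "x \<in> orb X \<omega>" "p = cover_section X x"
  | (history) h where "h \<in> histories X (cover_proj X p)" "p = history_point X h"
proof (cases "\<forall>k l y. k \<le> l \<longrightarrow> y \<in> p (k, l) \<longrightarrow> (\<exists>e. ancestors X l (suffix k y) = {e})")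
  case True
  then show ?thesis using cover_history[OF p] history by blast
next
  case False
  then obtain k l y where y: "k \<le> l" "y \<in> p (k, l)" "\<nexists>e. ancestors X l (suffix k y) = {e}" by blast
  then have yX: "y \<in> X" using cover_coordinate(2)[OF p, of "(k, l)"] by (auto simp: cover_index_def)
  \<comment> \<open>At least one ancestor always exists, so failure of uniqueness means that there
    are two.\<close>
  obtain e where e: "e \<in> X" "suffix l e = suffix k y" by (rule ex_ancestor[OF suffix_in[OF yX]])
  then have "e \<in> ancestors X l (suffix k y)" by (simp add: ancestors_def)
  moreover from this obtain f where "f \<in> ancestors X l (suffix k y)" "e \<noteq> f" using y(3) by blast
  ultimately show ?thesis using orbit orbI[OF yX] cover_determined[OF p y(1,2)] by metis
qed

section \<open>Cardinality of the fibres\<close>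

lemma cover_fibre_eq:
  assumes "x \<in> X"
  shows "cover_fibre X x =
    history_point X ` histories X x \<union> (if x \<in> orb X \<omega> then {cover_section X x} else {})"
proof (intro equalityI subsetI)
  fix p assume "p \<in> cover_fibre X x"
  then have p: "p \<in> cover X" "cover_proj X p = x" by (auto simp: cover_fibre_def)
  from p(1) show "p \<in> history_point X ` histories X x \<union> (if x \<in> orb X \<omega> then {cover_section X x} else {})"
  proof (cases rule: cover_cases)
    case (orbit z)
    then have "z \<in> X" by (auto simp: orb_def)
    then have "z = x" using orbit p cover_proj_section by metis
    then show ?thesis using orbit by simp
  next
    case (history h)
    then show ?thesis using p by simp
  qed
next
  fix p assume "p \<in> history_point X ` histories X x \<union> (if x \<in> orb X \<omega> then {cover_section X x} else {})"
  then show "p \<in> cover_fibre X x"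
    using history_point_in_cover cover_proj_history_point cover_section_in_cover[OF shift assms]
      cover_proj_section[OF assms]
    by (auto simp: cover_fibre_def split: if_splits)
qed

text \<open>Iterating a choice of preimages gives a history. It never meets \<open>\<omega>\<close>,
  since \<open>h n = \<omega>\<close> would make \<open>x\<close> the shift of
  \<open>\<omega>\<close> by \<open>n\<close>; hence every step to the left is forced.\<close>

lemma card_histories_non_forward:
  assumes x: "x \<in> X" "x \<notin> forward_orb \<omega>"
  shows "card (histories X x) = 1"
proof -
  have "\<forall>y\<in>X. \<exists>z. z \<in> X \<and> suffix 1 z = y" using ex_ancestor by blast
  then obtain f where f: "\<forall>y\<in>X. f y \<in> X \<and> suffix 1 (f y) = y" using bchoice by meson
  define h where "h n = (f ^^ n) x" for n
  have "h n \<in> X" for n by (induction n) (use x f in \<open>auto simp: h_def\<close>)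
  then have h: "h \<in> histories X x" using f by (simp add: histories_def h_def)
  moreover have "g = h" if g: "g \<in> histories X x" for g
  proof -
    have "g n = h n" for n
    proof (induction n)
      case 0
      then show ?case using g h by (simp add: histories_def)
    next
      case (Suc n)
      have "h n \<noteq> \<omega>"
        using suffix_history[OF h, of n n] h x(2) by (auto simp: forward_orb_def histories_def)
      then show ?case using Suc g h preimage_unique[of "g (Suc n)" "h (Suc n)"]
        by (simp add: histories_def)
    qed
    then show ?thesis by blast
  qed
  ultimately have "histories X x = {h}" by blast
  then show ?thesis by simp
qed

text \<open>At \<open>\<omega>\<close> each of the two preimages contributes one history: a preimage
  on the forward orbit would make \<open>\<omega>\<close> periodic. Further along the orbit the only
  preimage is the previous orbit point, so the number stays the same.\<close>

lemma card_histories_forward: "card (histories X (suffix k \<omega>)) = 2"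
proof (induction k)
  case 0
  have "card (ancestors X 1 \<omega>) = 2" using card_preimages[OF branch_in] by simp
  then obtain a b where ab: "ancestors X 1 \<omega> = {a, b}" "a \<noteq> b" by (auto simp: card_2_iff)
  have one: "card (histories X c) = 1" if c: "c \<in> ancestors X 1 \<omega>" for c
  proof (rule card_histories_non_forward)
    show "c \<notin> forward_orb \<omega>"
    proof
      assume "c \<in> forward_orb \<omega>"
      then obtain n where "c = suffix n \<omega>" by (auto simp: forward_orb_def)
      then have "suffix (n + 1) \<omega> = suffix 0 \<omega>" using c by (simp add: ancestors_def)
      then have "n + 1 = 0" by (rule aperiodic)
      then show False by simp
    qed
  qed (use c in \<open>auto simp: ancestors_def\<close>)
  obtain g h where gh: "histories X a = {g}" "histories X b = {h}"
    using one[of a] one[of b] ab by (auto simp: card_1_singleton_iff)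
  then have "g \<in> histories X a" "h \<in> histories X b" by simp_all
  then have "g 0 = a" "h 0 = b" by (simp_all add: histories_def)
  then have "g \<noteq> h" using ab(2) by auto
  then have "case_nat \<omega> g \<noteq> case_nat \<omega> h" using injD[OF inj_case_nat, of \<omega> g h] by blast
  moreover have "histories X \<omega> = {case_nat \<omega> g, case_nat \<omega> h}"
    unfolding histories_unfold[OF branch_in] ab(1) by (auto simp: gh)
  ultimately show ?case by simp
next
  case (Suc k)
  have X: "suffix (Suc k) \<omega> \<in> X" "suffix k \<omega> \<in> X" using suffix_in[OF branch_in] by auto
  have "suffix (Suc k) \<omega> \<noteq> \<omega>" using aperiodic[of "Suc k" 0] by auto
  then have "card (ancestors X 1 (suffix (Suc k) \<omega>)) = 1" using card_preimages[OF X(1)] by simp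
  moreover have "suffix k \<omega> \<in> ancestors X 1 (suffix (Suc k) \<omega>)" using X by (simp add: ancestors_def)
  ultimately have "ancestors X 1 (suffix (Suc k) \<omega>) = {suffix k \<omega>}" by (auto simp: card_1_singleton_iff)
  then have "histories X (suffix (Suc k) \<omega>) = case_nat (suffix (Suc k) \<omega>) ` histories X (suffix k \<omega>)"
    using histories_unfold[OF X(1)] by simp
  then show ?case using Suc inj_case_nat by (metis card_image inj_on_subset subset_UNIV)
qed

lemma card_cover_fibre:
  assumes "x \<in> X"
  shows "card (cover_fibre X x) =
    (if x \<in> forward_orb \<omega> then 2 else 1) + (if x \<in> orb X \<omega> then 1 else 0)"
proof -
  have c: "card (histories X x) = (if x \<in> forward_orb \<omega> then 2 else 1)"
    using card_histories_non_forward[OF assms] card_histories_forward by (auto simp: forward_orb_def)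
  \<comment> \<open>Infinite sets have \<open>card\<close> zero, so the value \<open>1\<close> or
    \<open>2\<close> entails finiteness.\<close>
  then have fin: "finite (histories X x)" by (metis card.infinite one_neq_zero zero_neq_numeral)
  have "card (history_point X ` histories X x) = card (histories X x)"
    by (rule card_image[OF inj_on_history_point])
  moreover have "cover_section X x \<notin> history_point X ` histories X x" if "x \<in> orb X \<omega>"
    using section_neq_history_point[OF that] by blast
  ultimately show ?thesis using c fin by (simp add: cover_fibre_eq[OF assms])
qed

lemma forward_orb_subset_orb: "forward_orb \<omega> \<subseteq> orb X \<omega>"
proof
  fix x assume "x \<in> forward_orb \<omega>"
  then obtain k where k: "x = suffix k \<omega>" by (auto simp: forward_orb_def)
  then have "x \<in> X" "suffix 0 x = suffix k \<omega>" using suffix_in[OF branch_in] by auto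
  then show "x \<in> orb X \<omega>" unfolding orb_def by blast
qed

section \<open>Isolated points of the cover\<close>

lemma isolated_points_cover:
  "isolated_points (cover_topology X) = cover_section X ` orb X \<omega>"
proof (intro equalityI subsetI)
  fix p assume "p \<in> isolated_points (cover_topology X)"
  then have p: "p \<in> cover X" "openin (cover_topology X) {p}"
    by (auto simp: isolated_points_def topspace_cover_topology)
  obtain j where j: "j \<in> cover_index" "\<And>q. q \<in> cover X \<Longrightarrow> q j = p j \<Longrightarrow> q \<in> {p}"
    by (rule open_contains_coordinate[OF p(2)]) auto
  from p(1) show "p \<in> cover_section X ` orb X \<omega>"
  proof (cases rule: cover_cases)
    case (history h)
    obtain k l where kl: "j = (k, l)" "k \<le> l" using j(1) by (auto simp: cover_index_def)
    \<comment> \<open>A history point cannot be isolated: its coordinate \<open>j\<close> contains a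
      word \<open>y\<close> other than its base point, and the section at \<open>y\<close> shares
      that coordinate but projects to \<open>y\<close>.\<close>
    have "infinite (p j)" using infinite_history_point[OF history(1) kl(2)] history(2) kl(1) by simp
    then obtain y where y: "y \<in> p j" "y \<noteq> cover_proj X p"
      by (metis finite.emptyI finite.insertI rev_finite_subset singletonI subsetI)
    then have yX: "y \<in> X" using cover_coordinate(2)[OF p(1) j(1)] by blast
    have "cover_section X y j = p j"
      using cover_coordinate(3)[OF p(1) j(1) y(1)] j(1) by (simp add: cover_section_def)
    then have "cover_section X y = p" using j(2) cover_section_in_cover[OF shift yX] by blast
    then show ?thesis using y(2) cover_proj_section[OF yX] by simp
  qed simp
next
  fix p assume "p \<in> cover_section X ` orb X \<omega>"
  then obtain x where x: "x \<in> orb X \<omega>" and p: "p = cover_section X x" by blast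
  have xX: "x \<in> X" using x by (auto simp: orb_def)
  have pc: "p \<in> cover X" using cover_section_in_cover[OF shift xX] p by simp
  obtain k l e f where kl: "k \<le> l" and ef: "e \<in> ancestors X l (suffix k x)"
    "f \<in> ancestors X l (suffix k x)" "e \<noteq> f"
    by (rule orb_coordinate[OF x])
  have i: "(k, l) \<in> cover_index" using kl by (simp add: cover_index_def)
  have x_mem: "x \<in> p (k, l)"
    using i xX by (auto simp: p cover_section_def past_class_def past_rel_def)
  \<comment> \<open>A coordinate with two pasts determines the whole point, so its cylinder is a
    singleton.\<close>
  have "q = p" if "q \<in> cover X" "q (k, l) = p (k, l)" for q
    using cover_determined[OF that(1) kl _ ef] that(2) x_mem p by simp
  then have "{q \<in> cover X. q (k, l) = p (k, l)} = {p}" using pc by blast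
  then show "p \<in> isolated_points (cover_topology X)"
    using openin_coordinate[OF i, of X "p (k, l)"] pc by (simp add: isolated_points_def topspace_cover_topology)
qed

end

section \<open>Sturmian subshifts\<close>

text \<open>Cylinders form a neighbourhood base: they are open, and a basic open set of the product
  constrains only letters below some \<open>n\<close>.\<close>

lemma closure_eq_prefix:
  fixes S :: "(nat \<Rightarrow> nat) set"
  shows "x \<in> closure S \<longleftrightarrow> (\<forall>n. \<exists>y\<in>S. prefix n y = prefix n x)"
proof
  assume x: "x \<in> closure S"
  show "\<forall>n. \<exists>y\<in>S. prefix n y = prefix n x"
  proof
    fix n
    have "open {f :: nat \<Rightarrow> nat. \<forall>i\<in>{..<n}. f (id i) \<in> {x i}}"
      by (rule product_topology_basis') (auto simp: open_discrete)
    then have "open {f. prefix n f = prefix n x}"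
      by (simp add: prefix_eq_iff Ball_def)
    then show "\<exists>y\<in>S. prefix n y = prefix n x"
      using x closure_iff_nhds_not_empty[of x S] by blast
  qed
next
  assume S: "\<forall>n. \<exists>y\<in>S. prefix n y = prefix n x"
  show "x \<in> closure S"
    unfolding closure_iff_nhds_not_empty
  proof (intro allI impI)
    fix A V assume V: "V \<subseteq> A" "open V" "x \<in> V"
    then obtain U where U: "finite {i. U i \<noteq> UNIV}" "x \<in> Pi\<^sub>E UNIV U" "Pi\<^sub>E UNIV U \<subseteq> V"
      unfolding open_fun_def openin_product_topology_alt by (auto dest!: bspec[of _ _ x])
    obtain n where n: "\<And>i. U i \<noteq> UNIV \<Longrightarrow> i < n"
      using U(1) unfolding finite_nat_set_iff_bounded by auto
    obtain y where y: "y \<in> S" "prefix n y = prefix n x" using S by blast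
    have "y i \<in> U i" for i
    proof (cases "i < n")
      case True
      then have "y i = x i" using y(2) by (simp add: prefix_eq_iff)
      then show ?thesis using U(2) by auto
    next
      case False
      then have "U i = UNIV" using n by blast
      then show ?thesis by simp
    qed
    then have "y \<in> V" using U(3) by auto
    then show "S \<inter> A \<noteq> {}" using y V by blast
  qed
qed

locale irrational_rotation =
  fixes \<alpha> :: real
  assumes pos: "0 < \<alpha>" and less_1: "\<alpha> < 1" and irrational: "\<alpha> \<notin> \<rat>"
begin

section \<open>Itineraries of the irrational rotation\<close>

definition itinerary :: "real \<Rightarrow> nat \<Rightarrow> nat" where
  "itinerary t = (\<lambda>i. coding \<alpha> ((rotation \<alpha> ^^ i) t))"

lemma sturmian_iff:
  "x \<in> sturmian \<alpha> \<longleftrightarrow> (\<forall>n. \<exists>t\<in>{0..<1}. prefix n (itinerary t) = prefix n x)"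
proof -
  have "sturmian \<alpha> = closure (itinerary ` {0..<1})"
    unfolding sturmian_def itinerary_def by (rule arg_cong[of _ _ closure]) auto
  then show ?thesis by (simp add: closure_eq_prefix)
qed

lemma itinerary_in: "t \<in> {0..<1} \<Longrightarrow> itinerary t \<in> sturmian \<alpha>"
  unfolding sturmian_iff by blast

lemma rotation_in: "rotation \<alpha> t \<in> {0..<1}"
  by (simp add: rotation_def frac_lt_1)

lemma rotation_eq:
  assumes "t \<in> {0..<1}"
  shows "rotation \<alpha> t = (if t < 1 - \<alpha> then t + \<alpha> else t + \<alpha> - 1)"
  unfolding rotation_def frac_unique_iff using assms pos less_1 by auto

lemma rotation_funpow: "t \<in> {0..<1} \<Longrightarrow> (rotation \<alpha> ^^ n) t = frac (t + n * \<alpha>)"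
proof (induction n)
  case 0
  then show ?case by (simp add: frac_eq)
next
  case (Suc n)
  have "frac (t + n * \<alpha>) + \<alpha> - frac (t + Suc n * \<alpha>) = of_int (\<lfloor>t + Suc n * \<alpha>\<rfloor> - \<lfloor>t + n * \<alpha>\<rfloor>)"
    by (simp add: frac_def algebra_simps)
  then have "frac (t + n * \<alpha>) + \<alpha> - frac (t + Suc n * \<alpha>) \<in> \<int>" by (metis Ints_of_int)
  then have "rotation \<alpha> (frac (t + n * \<alpha>)) = frac (t + Suc n * \<alpha>)"
    unfolding rotation_def frac_unique_iff by (simp add: frac_lt_1)
  then show ?case using Suc by simp
qed

lemma itinerary_0: "itinerary t 0 = (if t < 1 - \<alpha> then 0 else 1)"
  by (simp add: itinerary_def coding_def)

lemma itinerary_rotation: "itinerary (rotation \<alpha> t) = suffix 1 (itinerary t)"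
  by (rule ext) (simp add: itinerary_def funpow_swap1)

lemma prefix_itinerary_Suc:
  "prefix (Suc n) (itinerary s) = prefix (Suc n) (itinerary t) \<longleftrightarrow>
    (s < 1 - \<alpha> \<longleftrightarrow> t < 1 - \<alpha>) \<and>
    prefix n (itinerary (rotation \<alpha> s)) = prefix n (itinerary (rotation \<alpha> t))"
  unfolding prefix_eq_iff itinerary_rotation by (auto simp: itinerary_0 less_Suc_eq_0_disj)

text \<open>As long as two points have equal itineraries, the rotation moves them by the same translation.\<close>

lemma itinerary_between:
  assumes "r \<in> {0..<1}" "t \<in> {0..<1}" "r \<le> s" "s \<le> t"
    and "prefix n (itinerary r) = prefix n (itinerary t)"
  shows "prefix n (itinerary s) = prefix n (itinerary r)"
  using assms
proof (induction n arbitrary: r s t)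
  case (Suc n)
  have side: "r < 1 - \<alpha> \<longleftrightarrow> t < 1 - \<alpha>" "s < 1 - \<alpha> \<longleftrightarrow> r < 1 - \<alpha>"
    and pre: "prefix n (itinerary (rotation \<alpha> r)) = prefix n (itinerary (rotation \<alpha> t))"
    using Suc.prems unfolding prefix_itinerary_Suc by auto
  have s: "s \<in> {0..<1}" using Suc.prems by auto
  have "rotation \<alpha> r \<le> rotation \<alpha> s" "rotation \<alpha> s \<le> rotation \<alpha> t"
    using Suc.prems s side by (auto simp: rotation_eq)
  then have "prefix n (itinerary (rotation \<alpha> s)) = prefix n (itinerary (rotation \<alpha> r))"
    using Suc.IH[OF rotation_in rotation_in _ _ pre] by blast
  then show ?case unfolding prefix_itinerary_Suc using side by blast
qed simp

lemma itinerary_translation: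
  assumes "s \<in> {0..<1}" "t \<in> {0..<1}" "itinerary s = itinerary t"
  shows "(rotation \<alpha> ^^ n) t - (rotation \<alpha> ^^ n) s = t - s"
  using assms
proof (induction n arbitrary: s t)
  case (Suc n)
  have "s < 1 - \<alpha> \<longleftrightarrow> t < 1 - \<alpha>"
    using fun_cong[OF Suc.prems(3), of 0] by (auto simp: itinerary_0 split: if_splits)
  then have "rotation \<alpha> t - rotation \<alpha> s = t - s"
    using Suc.prems by (auto simp: rotation_eq)
  moreover have "itinerary (rotation \<alpha> s) = itinerary (rotation \<alpha> t)"
    using Suc.prems by (simp add: itinerary_rotation)
  ultimately show ?case
    using Suc.IH[OF rotation_in rotation_in] by (simp add: funpow_swap1)
qed simp

lemma rotation_dense:
  assumes t: "t \<in> {0..<1}" and d: "0 < d" "d < 1"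
  obtains n where "1 - d \<le> (rotation \<alpha> ^^ n) t"
proof -
  \<comment> \<open>The translation by \<open>b\<close> carries \<open>t\<close> to the centre of
    the interval from \<open>1 - d\<close> to \<open>1\<close>; a Kronecker error below
    \<open>d / 2\<close> keeps the orbit point inside.\<close>
  define b where "b = frac (1 - d / 2 - t)"
  have "0 \<le> b" "b \<le> 1" by (auto simp: b_def less_imp_le frac_lt_1)
  then obtain k where k: "\<bar>frac (real k * \<alpha>) - b\<bar> < d / 2"
    using Kronecker_approx_1_explicit[OF irrational, of b "d / 2"] d by auto
  define c where "c = frac (real k * \<alpha>) - b"
  have c: "- (d / 2) < c" "c < d / 2" using k unfolding c_def by linarith+
  have "(rotation \<alpha> ^^ k) t = 1 - d / 2 + c"
    unfolding rotation_funpow[OF t] frac_unique_iff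
  proof (intro conjI)
    have "t + real k * \<alpha> - (1 - d / 2 + c) = of_int (\<lfloor>real k * \<alpha>\<rfloor> - \<lfloor>1 - d / 2 - t\<rfloor>)"
      by (simp add: c_def b_def frac_def)
    then show "t + real k * \<alpha> - (1 - d / 2 + c) \<in> \<int>" by (metis Ints_of_int)
  qed (use c d in auto)
  then show ?thesis using that[of k] c by simp
qed

text \<open>Points with equal itineraries keep their distance \<open>t - s\<close> forever. Once
  density brings the orbit of \<open>s\<close> within that distance of \<open>1\<close>, the orbit
  of \<open>t\<close> would leave the fundamental domain.\<close>

lemma itinerary_inj: "inj_on itinerary {0..<1}"
proof (rule linorder_inj_onI)
  fix s t :: real
  assume st: "s < t" "s \<in> {0..<1}" "t \<in> {0..<1}"
  show "itinerary s \<noteq> itinerary t"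
  proof
    assume eq: "itinerary s = itinerary t"
    obtain n where n: "1 - (t - s) \<le> (rotation \<alpha> ^^ n) s"
      using rotation_dense[of s "t - s"] st by auto
    have "(rotation \<alpha> ^^ n) t < 1" using st rotation_funpow by (simp add: frac_lt_1)
    then show False using itinerary_translation[OF st(2,3) eq, of n] n by simp
  qed
qed auto

text \<open>Both coding intervals are closed on the left and open on the right, so a small move to
  the right crosses no endpoint during the first \<open>n\<close> rotations.\<close>

lemma itinerary_right_continuous:
  assumes "t \<in> {0..<1}"
  shows "\<exists>\<epsilon>>0. \<forall>s. t \<le> s \<and> s < t + \<epsilon> \<longrightarrow> s < 1 \<and> prefix n (itinerary s) = prefix n (itinerary t)"
  using assms
proof (induction n arbitrary: t)
  case 0
  then show ?case by (intro exI[of _ "1 - t"]) auto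
next
  case (Suc n)
  obtain \<delta> where \<delta>: "\<delta> > 0" "\<And>s. rotation \<alpha> t \<le> s \<Longrightarrow> s < rotation \<alpha> t + \<delta> \<Longrightarrow>
      prefix n (itinerary s) = prefix n (itinerary (rotation \<alpha> t))"
    using Suc.IH[OF rotation_in, of t] by blast
  \<comment> \<open>The second bound stops at the right end of the coding interval of
    \<open>t\<close>, which preserves the first letter and keeps \<open>s\<close> below
    \<open>1\<close>.\<close>
  define \<epsilon> where "\<epsilon> = min \<delta> (if t < 1 - \<alpha> then 1 - \<alpha> - t else 1 - t)"
  have "\<epsilon> > 0" using \<delta> Suc.prems by (auto simp: \<epsilon>_def)
  moreover have "s < 1 \<and> prefix (Suc n) (itinerary s) = prefix (Suc n) (itinerary t)"
    if s: "t \<le> s" "s < t + \<epsilon>" for s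
  proof -
    have s1: "s < 1" and side: "s < 1 - \<alpha> \<longleftrightarrow> t < 1 - \<alpha>" and "s < t + \<delta>"
      using s pos Suc.prems by (auto simp: \<epsilon>_def split: if_splits)
    then have "rotation \<alpha> s = rotation \<alpha> t + (s - t)"
      using s Suc.prems by (auto simp: rotation_eq)
    then have "prefix n (itinerary (rotation \<alpha> s)) = prefix n (itinerary (rotation \<alpha> t))"
      using s \<open>s < t + \<delta>\<close> by (intro \<delta>(2)) linarith+
    then show ?thesis using s1 side unfolding prefix_itinerary_Suc by blast
  qed
  ultimately show ?case by blast
qed

text \<open>Moving to the left changes a letter only when an iterate sits at the left end
  \<open>0\<close> or \<open>1 - \<alpha>\<close> of a coding interval; these positions are
  excluded.\<close>

lemma itinerary_left_continuous:
  assumes "t \<in> {0..<1}" and "\<And>i. i < n \<Longrightarrow> (rotation \<alpha> ^^ i) t \<notin> {0, 1 - \<alpha>}"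
  shows "\<exists>\<epsilon>>0. \<forall>s. t - \<epsilon> < s \<and> s \<le> t \<longrightarrow> prefix n (itinerary s) = prefix n (itinerary t)"
  using assms
proof (induction n arbitrary: t)
  case 0
  then show ?case by (intro exI[of _ 1]) auto
next
  case (Suc n)
  have "(rotation \<alpha> ^^ i) (rotation \<alpha> t) \<notin> {0, 1 - \<alpha>}" if "i < n" for i
    using Suc.prems(2)[of "Suc i"] that by (simp add: funpow_swap1)
  then obtain \<delta> where \<delta>: "\<delta> > 0" "\<And>s. rotation \<alpha> t - \<delta> < s \<Longrightarrow> s \<le> rotation \<alpha> t \<Longrightarrow>
      prefix n (itinerary s) = prefix n (itinerary (rotation \<alpha> t))"
    using Suc.IH[OF rotation_in, of t] by blast
  have t: "t \<noteq> 0" "t \<noteq> 1 - \<alpha>" using Suc.prems(2)[of 0] by auto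
  define \<epsilon> where "\<epsilon> = min \<delta> (if t < 1 - \<alpha> then t else t - (1 - \<alpha>))"
  have "\<epsilon> > 0" using \<delta> Suc.prems t by (auto simp: \<epsilon>_def)
  moreover have "prefix (Suc n) (itinerary s) = prefix (Suc n) (itinerary t)"
    if s: "t - \<epsilon> < s" "s \<le> t" for s
  proof -
    have s1: "s \<in> {0..<1}" and side: "s < 1 - \<alpha> \<longleftrightarrow> t < 1 - \<alpha>" and "t - \<delta> < s"
      using s pos less_1 Suc.prems by (auto simp: \<epsilon>_def split: if_splits)
    then have "rotation \<alpha> s = rotation \<alpha> t + (s - t)"
      using s Suc.prems by (auto simp: rotation_eq)
    then have "prefix n (itinerary (rotation \<alpha> s)) = prefix n (itinerary (rotation \<alpha> t))"
      using s \<open>t - \<delta> < s\<close> by (intro \<delta>(2)) linarith+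
    then show ?thesis using side unfolding prefix_itinerary_Suc by blast
  qed
  ultimately show ?case by blast
qed

section \<open>The itinerary of \<alpha>\<close>

lemma multiple_not_int: "n > 0 \<Longrightarrow> real n * \<alpha> \<notin> \<int>"
proof
  assume n: "n > 0" and "real n * \<alpha> \<in> \<int>"
  then obtain k where "real n * \<alpha> = of_int k" by (auto elim: Ints_cases)
  then have "\<alpha> = of_int k / real n" using n by (simp add: field_simps)
  then show False using irrational by auto
qed

text \<open>The rotation carries the coding intervals of \<open>0\<close> and \<open>1\<close> onto
  those from \<open>\<alpha>\<close> to \<open>1\<close> and from \<open>0\<close> to
  \<open>\<alpha>\<close>. Hence \<open>\<alpha>\<close> is the interior point at which both
  preceding letters can be approached.\<close>

definition critical :: "nat \<Rightarrow> nat" where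
  "critical = itinerary \<alpha>"

lemma alpha_in: "\<alpha> \<in> {0..<1}"
  using pos less_1 by simp

lemma rotation_funpow_alpha: "(rotation \<alpha> ^^ n) \<alpha> = frac (Suc n * \<alpha>)"
  using rotation_funpow[OF alpha_in] by (simp add: algebra_simps)

text \<open>Reaching \<open>0\<close> or \<open>1 - \<alpha>\<close> would make the multiple of
  \<open>\<alpha>\<close> by \<open>Suc n\<close> or \<open>Suc (Suc n)\<close> an integer.\<close>

lemma rotation_funpow_alpha_notin: "(rotation \<alpha> ^^ n) \<alpha> \<notin> {0, 1 - \<alpha>}"
proof
  assume "(rotation \<alpha> ^^ n) \<alpha> \<in> {0, 1 - \<alpha>}"
  then have "frac (Suc n * \<alpha>) = 0 \<or> frac (Suc n * \<alpha>) = 1 - \<alpha>"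
    unfolding rotation_funpow_alpha by blast
  then have "Suc n * \<alpha> \<in> \<int> \<or> Suc n * \<alpha> - (1 - \<alpha>) \<in> \<int>"
    by (metis frac_eq_0_iff frac_unique_iff)
  moreover have "Suc n * \<alpha> - (1 - \<alpha>) + 1 = Suc (Suc n) * \<alpha>" by (simp add: algebra_simps)
  ultimately have "Suc n * \<alpha> \<in> \<int> \<or> Suc (Suc n) * \<alpha> \<in> \<int>"
    by (metis Ints_1 Ints_add)
  then show False using multiple_not_int[of "Suc n"] multiple_not_int[of "Suc (Suc n)"] by simp
qed

text \<open>Equal shifts are equal itineraries of orbit points of \<open>\<alpha>\<close>, so these
  points coincide, and a nonzero multiple of \<open>\<alpha>\<close> would be an integer unless
  \<open>m = n\<close>.\<close>

lemma critical_aperiodic: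
  assumes "suffix m critical = suffix n critical"
  shows "m = n"
proof (rule ccontr)
  assume "m \<noteq> n"
  have suf: "suffix k (itinerary t) = itinerary ((rotation \<alpha> ^^ k) t)" for k t
    by (rule ext) (simp add: itinerary_def funpow_add add.commute)
  have "(rotation \<alpha> ^^ m) \<alpha> = (rotation \<alpha> ^^ n) \<alpha>"
    using assms rotation_funpow[OF alpha_in] unfolding critical_def suf
    by (intro inj_onD[OF itinerary_inj]) (auto simp: frac_lt_1)
  then have "frac (Suc m * \<alpha>) = frac (Suc n * \<alpha>)" unfolding rotation_funpow_alpha .
  moreover have "x - y \<in> \<int>" if "frac x = frac y" for x y :: real
  proof -
    have "x - y = of_int (\<lfloor>x\<rfloor> - \<lfloor>y\<rfloor>)" using that by (simp add: frac_def algebra_simps)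
    then show ?thesis by (metis Ints_of_int)
  qed
  ultimately have i: "Suc m * \<alpha> - Suc n * \<alpha> \<in> \<int>" "Suc n * \<alpha> - Suc m * \<alpha> \<in> \<int>" by simp_all
  show False
  proof (cases "m < n")
    case True
    then have "Suc n * \<alpha> - Suc m * \<alpha> = real (n - m) * \<alpha>" by (simp add: of_nat_diff algebra_simps)
    then show ?thesis using i multiple_not_int[of "n - m"] True by simp
  next
    case False
    then have "Suc m * \<alpha> - Suc n * \<alpha> = real (m - n) * \<alpha>" by (simp add: of_nat_diff algebra_simps)
    then show ?thesis using i multiple_not_int[of "m - n"] False \<open>m \<noteq> n\<close> by simp
  qed
qed

section \<open>Shift invariance and the branch point\<close>

lemma letters:
  assumes "x \<in> sturmian \<alpha>"
  shows "x i = 0 \<or> x i = 1"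
proof -
  obtain t where "prefix (Suc i) (itinerary t) = prefix (Suc i) x"
    using assms unfolding sturmian_iff by blast
  then have "x i = itinerary t i" by (simp add: prefix_eq_iff)
  then show ?thesis by (simp add: itinerary_def coding_def)
qed

lemma sturmian_shift: "suffix 1 ` sturmian \<alpha> = sturmian \<alpha>"
proof (intro equalityI subsetI)
  fix x assume "x \<in> suffix 1 ` sturmian \<alpha>"
  then obtain y where y: "y \<in> sturmian \<alpha>" "x = suffix 1 y" by blast
  show "x \<in> sturmian \<alpha>"
    unfolding sturmian_iff
  proof
    fix n
    obtain t where "prefix (Suc n) (itinerary t) = prefix (Suc n) y"
      using y(1) unfolding sturmian_iff by blast
    then have "prefix n (itinerary (rotation \<alpha> t)) = prefix n x"
      unfolding y(2) itinerary_rotation prefix_Suc_eq_iff by blast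
    then show "\<exists>t\<in>{0..<1}. prefix n (itinerary t) = prefix n x" using rotation_in by blast
  qed
next
  fix x assume x: "x \<in> sturmian \<alpha>"
  \<comment> \<open>\<open>Q a n\<close> says that \<open>a ## x\<close> is approximated by an
    itinerary up to length \<open>Suc n\<close>.\<close>
  define Q where "Q a n \<longleftrightarrow> (\<exists>t\<in>{0..<1}. prefix (Suc n) (itinerary t) = prefix (Suc n) (a ## x))" for a n
  have anti: "Q a m" if Q: "Q a n" "m \<le> n" for a m n
  proof -
    obtain t where t: "t \<in> {0..<1}" "prefix (Suc n) (itinerary t) = prefix (Suc n) (a ## x)"
      using Q(1) unfolding Q_def by blast
    have "prefix (Suc m) (itinerary t) = prefix (Suc m) (a ## x)"
      by (rule prefix_eq_mono[OF t(2)]) (use Q in simp)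
    then show ?thesis using t(1) unfolding Q_def by blast
  qed
  have ex: "\<exists>a\<in>{0, 1}. Q a n" for n
  proof -
    obtain t where t: "t \<in> {0..<1}" "prefix n (itinerary t) = prefix n x"
      using x unfolding sturmian_iff by blast
    define s where "s = frac (t - \<alpha>)"
    have s: "s \<in> {0..<1}" by (simp add: s_def frac_lt_1)
    have "rotation \<alpha> s = t"
      unfolding rotation_def frac_unique_iff using t by (auto simp: s_def frac_def)
    then have "prefix n (suffix 1 (itinerary s)) = prefix n x"
      using t(2) unfolding itinerary_rotation[symmetric] by simp
    then have "prefix (Suc n) (itinerary s) = prefix (Suc n) (itinerary s 0 ## x)"
      unfolding prefix_build_eq_iff by blast
    then have "Q (itinerary s 0) n" using s unfolding Q_def by blast
    then show ?thesis by (auto simp: itinerary_0 split: if_splits)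
  qed
  \<comment> \<open>Pigeonhole on two letters: if each failed at some length, both would fail at the
    larger one, because approximations restrict to shorter prefixes.\<close>
  have "\<exists>a. \<forall>n. Q a n"
  proof (rule ccontr)
    assume "\<not> ?thesis"
    then obtain m n where "\<not> Q 0 m" "\<not> Q 1 n" by blast
    then show False using ex[of "max m n"] anti[of _ "max m n"] by auto
  qed
  then obtain a where a: "\<forall>n. Q a n" by blast
  have "a ## x \<in> sturmian \<alpha>"
    unfolding sturmian_iff
  proof
    fix n
    obtain t where t: "t \<in> {0..<1}" "prefix (Suc n) (itinerary t) = prefix (Suc n) (a ## x)"
      using a unfolding Q_def by blast
    have "prefix n (itinerary t) = prefix n (a ## x)" by (rule prefix_eq_mono[OF t(2)]) simp
    then show "\<exists>t\<in>{0..<1}. prefix n (itinerary t) = prefix n (a ## x)" using t(1) by blast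
  qed
  then show "x \<in> suffix 1 ` sturmian \<alpha>" by (intro image_eqI[of _ _ "a ## x"]) auto
qed

lemma critical_in: "critical \<in> sturmian \<alpha>"
  unfolding critical_def by (rule itinerary_in[OF alpha_in])

lemma zero_critical_in: "0 ## critical \<in> sturmian \<alpha>"
proof -
  have "rotation \<alpha> 0 = \<alpha>" "itinerary 0 0 = 0"
    using rotation_eq[of 0] less_1 by (simp_all add: itinerary_0)
  then have "itinerary 0 = 0 ## critical"
    using itinerary_rotation[of 0] build_split[of "itinerary 0"] by (simp add: critical_def)
  then show ?thesis using itinerary_in[of 0] by simp
qed

text \<open>The positive orbit of \<open>\<alpha>\<close> avoids the discontinuities, hence \<open>critical\<close> is also the limit of the
  itineraries of the points approaching \<open>\<alpha>\<close> from the left, whose preimages lie close to \<open>1\<close>.\<close>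

lemma one_critical_in: "1 ## critical \<in> sturmian \<alpha>"
  unfolding sturmian_iff
proof
  fix n
  obtain \<epsilon> where \<epsilon>: "\<epsilon> > 0"
    "\<And>s. \<alpha> - \<epsilon> < s \<Longrightarrow> s \<le> \<alpha> \<Longrightarrow> prefix n (itinerary s) = prefix n critical"
    using itinerary_left_continuous[OF alpha_in rotation_funpow_alpha_notin, of n]
    unfolding critical_def by blast
  \<comment> \<open>The bound \<open>\<alpha>\<close> ensures that \<open>1 - \<delta>\<close> is
    coded by \<open>1\<close>; halving \<open>\<epsilon>\<close> makes the other inequality
    strict.\<close>
  define \<delta> where "\<delta> = min (\<epsilon> / 2) \<alpha>"
  have \<delta>: "0 < \<delta>" "\<delta> \<le> \<alpha>" "\<delta> < \<epsilon>" using \<epsilon>(1) pos by (auto simp: \<delta>_def)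
  have t: "1 - \<delta> \<in> {0..<1}" using \<delta> less_1 by auto
  have "\<not> 1 - \<delta> < 1 - \<alpha>" using \<delta> by simp
  then have "rotation \<alpha> (1 - \<delta>) = \<alpha> - \<delta>" "itinerary (1 - \<delta>) 0 = 1"
    using rotation_eq[OF t] by (simp_all add: itinerary_0)
  then have "prefix (Suc n) (itinerary (1 - \<delta>)) = prefix (Suc n) (1 ## critical)"
    using \<epsilon>(2)[of "\<alpha> - \<delta>"] \<delta> unfolding prefix_build_eq_iff itinerary_rotation[symmetric] by simp
  then have "prefix n (itinerary (1 - \<delta>)) = prefix n (1 ## critical)" by (rule prefix_eq_mono) simp
  then show "\<exists>t\<in>{0..<1}. prefix n (itinerary t) = prefix n (1 ## critical)" using t by blast
qed

text \<open>
  Points of the circle that have a common itinerary but preimages with different first letters lie on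
  different sides of \<open>\<alpha>\<close>.
\<close>

lemma zero_one_branching_eq_critical:
  assumes y: "y \<in> sturmian \<alpha>" "y 0 = 0" and z: "z \<in> sturmian \<alpha>" "z 0 = 1"
    and eq: "suffix 1 y = suffix 1 z"
  shows "suffix 1 y = critical"
proof -
  have "prefix n (suffix 1 y) = prefix n critical" for n
  proof -
    obtain t where t: "t \<in> {0..<1}" "prefix (Suc n) (itinerary t) = prefix (Suc n) y"
      using y(1) unfolding sturmian_iff by blast
    obtain u where u: "u \<in> {0..<1}" "prefix (Suc n) (itinerary u) = prefix (Suc n) z"
      using z(1) unfolding sturmian_iff by blast
    have "itinerary t 0 = 0" "itinerary u 0 = 1"
      using t(2) u(2) y(2) z(2) unfolding prefix_Suc_eq_iff by auto
    then have "t < 1 - \<alpha>" "\<not> u < 1 - \<alpha>" by (auto simp: itinerary_0 split: if_splits)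
    then have le: "rotation \<alpha> u \<le> \<alpha>" "\<alpha> \<le> rotation \<alpha> t"
      using t(1) u(1) by (auto simp: rotation_eq)
    have pre: "prefix n (itinerary (rotation \<alpha> u)) = prefix n (suffix 1 z)"
      "prefix n (itinerary (rotation \<alpha> t)) = prefix n (suffix 1 y)"
      using t(2) u(2) unfolding itinerary_rotation prefix_Suc_eq_iff by auto
    have "prefix n (itinerary \<alpha>) = prefix n (itinerary (rotation \<alpha> u))"
      by (rule itinerary_between[OF rotation_in rotation_in le]) (simp only: pre eq)
    then show ?thesis using pre(1) eq by (simp only: critical_def)
  qed
  then show ?thesis unfolding prefix_eq_iff by blast
qed

lemma branching_eq_critical:
  assumes "y \<in> sturmian \<alpha>" "z \<in> sturmian \<alpha>" "y \<noteq> z" "suffix 1 y = suffix 1 z"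
  shows "suffix 1 y = critical"
proof -
  have "y 0 \<noteq> z 0" using assms(3,4) build_split by metis
  then have "y 0 = 0 \<and> z 0 = 1 \<or> y 0 = 1 \<and> z 0 = 0"
    using letters[OF assms(1), of 0] letters[OF assms(2), of 0] by auto
  then show ?thesis using zero_one_branching_eq_critical[of y z] zero_one_branching_eq_critical[of z y] assms by metis
qed

lemma branch_point_eq: "branch_point (sturmian \<alpha>) = critical"
  unfolding branch_point_def
proof (rule the_equality)
  have "0 ## critical \<noteq> 1 ## critical" by simp
  moreover have "suffix 1 (a ## critical) = critical" for a by simp
  ultimately show "critical \<in> sturmian \<alpha> \<and>
      (\<exists>y\<in>sturmian \<alpha>. \<exists>z\<in>sturmian \<alpha>. y \<noteq> z \<and> suffix 1 y = critical \<and> suffix 1 z = critical)"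
    using critical_in zero_critical_in one_critical_in by metis
qed (use branching_eq_critical in metis)

text \<open>Right continuity provides a whole interval of points sharing the first \<open>n\<close>
  letters, and their itineraries are pairwise distinct.\<close>

lemma infinite_cylinder:
  assumes "x \<in> sturmian \<alpha>"
  shows "infinite {y \<in> sturmian \<alpha>. prefix n y = prefix n x}"
proof -
  obtain t where t: "t \<in> {0..<1}" "prefix n (itinerary t) = prefix n x"
    using assms unfolding sturmian_iff by blast
  obtain \<epsilon> where \<epsilon>: "\<epsilon> > 0"
    "\<And>s. t \<le> s \<Longrightarrow> s < t + \<epsilon> \<Longrightarrow> s < 1 \<and> prefix n (itinerary s) = prefix n (itinerary t)"
    using itinerary_right_continuous[OF t(1), of n] by blast
  have sub: "{t..<t + \<epsilon>} \<subseteq> {0..<1}"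
  proof
    fix s assume "s \<in> {t..<t + \<epsilon>}"
    then show "s \<in> {0..<1}" using t(1) \<epsilon>(2)[of s] by simp
  qed
  have "infinite (itinerary ` {t..<t + \<epsilon>})"
    using finite_imageD[OF _ inj_on_subset[OF itinerary_inj sub]] infinite_Ico[of t "t + \<epsilon>"] \<epsilon>(1) by auto
  moreover have "itinerary ` {t..<t + \<epsilon>} \<subseteq> {y \<in> sturmian \<alpha>. prefix n y = prefix n x}"
  proof clarify
    fix s assume s: "s \<in> {t..<t + \<epsilon>}"
    then have "itinerary s \<in> sturmian \<alpha>" using sub itinerary_in by blast
    moreover have "prefix n (itinerary s) = prefix n x" using \<epsilon>(2)[of s] s t(2) by simp
    ultimately show "itinerary s \<in> sturmian \<alpha> \<and> prefix n (itinerary s) = prefix n x" by blast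
  qed
  ultimately show ?thesis using infinite_super by blast
qed

section \<open>The Sturmian subshift as a branching shift\<close>

sublocale branching_shift "sturmian \<alpha>" critical
proof
  show "x \<in> sturmian \<alpha>" if limit: "\<And>n. \<exists>y\<in>sturmian \<alpha>. prefix n y = prefix n x" for x
    unfolding sturmian_iff
  proof
    fix n
    obtain y where y: "y \<in> sturmian \<alpha>" "prefix n y = prefix n x" using limit by blast
    then obtain t where "t \<in> {0..<1}" "prefix n (itinerary t) = prefix n y"
      unfolding sturmian_iff by blast
    then show "\<exists>t\<in>{0..<1}. prefix n (itinerary t) = prefix n x" using y(2) by (intro bexI[of _ t]) simp_all
  qed
  show "suffix 1 ` sturmian \<alpha> = sturmian \<alpha>" by (rule sturmian_shift)
  show "infinite {y \<in> sturmian \<alpha>. prefix n y = prefix n x}" if "x \<in> sturmian \<alpha>" for x n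
    by (rule infinite_cylinder[OF that])
  show "critical \<in> sturmian \<alpha>" by (rule critical_in)
  show "m = n" if "suffix m critical = suffix n critical" for m n
    by (rule critical_aperiodic[OF that])
  show "card (ancestors (sturmian \<alpha>) 1 x) = (if x = critical then 2 else 1)" if x: "x \<in> sturmian \<alpha>" for x
  proof (cases "x = critical")
    case True
    have "ancestors (sturmian \<alpha>) 1 x = {0 ## critical, 1 ## critical}"
    proof (intro equalityI subsetI)
      fix y assume "y \<in> ancestors (sturmian \<alpha>) 1 x"
      then have y: "y \<in> sturmian \<alpha>" "suffix 1 y = critical" using True by (auto simp: ancestors_def)
      then have "y = y 0 ## critical" using build_split[of y] by simp
      then show "y \<in> {0 ## critical, 1 ## critical}" using letters[OF y(1), of 0] by auto
    qed (use True zero_critical_in one_critical_in in \<open>auto simp: ancestors_def\<close>)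
    then show ?thesis using True by simp
  next
    case False
    obtain y where y: "y \<in> sturmian \<alpha>" "x = suffix 1 y" using x sturmian_shift by blast
    have "z = y" if "z \<in> ancestors (sturmian \<alpha>) 1 x" for z
      using branching_eq_critical[of z y] that y False by (auto simp: ancestors_def)
    then have "ancestors (sturmian \<alpha>) 1 x = {y}" using y unfolding ancestors_def by blast
    then show ?thesis using False by simp
  qed
qed

end

theorem theorem4p11:
  fixes \<alpha> :: real
  assumes "0 < \<alpha>" and "\<alpha> < 1" and "\<alpha> \<notin> \<rat>"
  shows "(\<forall>x \<in> forward_orb (branch_point (sturmian \<alpha>)).
            card (cover_fibre (sturmian \<alpha>) x) = 3)
    \<and> (\<forall>x \<in> backward_orb (sturmian \<alpha>) (branch_point (sturmian \<alpha>)).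
            card (cover_fibre (sturmian \<alpha>) x) = 2)
    \<and> (\<forall>x \<in> sturmian \<alpha> - orb (sturmian \<alpha>) (branch_point (sturmian \<alpha>)).
            card (cover_fibre (sturmian \<alpha>) x) = 1)
    \<and> cover_section (sturmian \<alpha>) ` orb (sturmian \<alpha>) (branch_point (sturmian \<alpha>))
        = isolated_points (cover_topology (sturmian \<alpha>))"
proof -
  interpret irrational_rotation \<alpha> by standard (use assms in auto)
  have sub: "orb (sturmian \<alpha>) critical \<subseteq> sturmian \<alpha>" by (auto simp: orb_def)
  have "card (cover_fibre (sturmian \<alpha>) x) = 3" if "x \<in> forward_orb critical" for x
  proof -
    have "x \<in> orb (sturmian \<alpha>) critical" using that forward_orb_subset_orb by blast
    then show ?thesis using that sub card_cover_fibre[of x] by auto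
  qed
  moreover have "card (cover_fibre (sturmian \<alpha>) x) = 2" if "x \<in> backward_orb (sturmian \<alpha>) critical" for x
    using that sub card_cover_fibre[of x] by (auto simp: backward_orb_def)
  moreover have "card (cover_fibre (sturmian \<alpha>) x) = 1" if "x \<in> sturmian \<alpha> - orb (sturmian \<alpha>) critical" for x
    using that forward_orb_subset_orb card_cover_fibre[of x] by auto
  ultimately show ?thesis
    unfolding branch_point_eq using isolated_points_cover by simp
qed

end
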